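(* Let $(X,d,m)$ be an ergodic random walk on a metric space, with invariant distribution $\nu$. Suppose that the Ricci curvature of $X$ is at least $\kappa>0$ and that $\sigma<\infty$. Suppose that $\nu$ is reversible. Then the smallest eigenvalue of $-\Delta$ on $L^2(X,\nu)/\{\mathrm{const}\}$ is at least $\kappa$. Moreover the following discrete Poincaré inequalities are satisfied for $f\in L^2(X,\nu)$: $$\mathrm{Var}_\nu f\leq\frac{1}{\kappa(2-\kappa)}\int\mathrm{Var}_{m_x}f\,\mathrm{d}\nu(x)$$ and $$\mathrm{Var}_\nu f\leq\frac{1}{2\kappa}\iint(f(y)-f(x))^2\,\mathrm{d}\nu(x)\,\mathrm{d}m_x(y).$$
   Context: $(X,d)$ is a Polish metric space with its Borel $\sigma$-algebra. A random walk $m$ on $X$ is a family of probability measures $(m_x)_{x\in X}$ on $X$, depending measurably on $x$, each having finite first moment. The $L^1$ transportation distance is $\mathcal{T}_1(\nu_1,\nu_2):=\inf_{\xi}\int_{X\times X} d(x,y)\,\mathrm{d}\xi(x,y)$, over all measures $\xi$ with marginals $\nu_1,\nu_2$. For distinct points $x,y$, $\kappa(x,y):=1-\frac{\mathcal{T}_1(m_x,m_y)}{d(x,y)}$; "the Ricci curvature of $X$ is at least $\kappa$" means $\kappa(x,y)\geq\kappa$ for all distinct $x,y$. A probability measure $\nu$ is invariant if $\mathrm{d}\nu(x)=\int_y\mathrm{d}\nu(y)\,\mathrm{d}m_y(x)$, and reversible if moreover $\mathrm{d}\nu(x)\,\mathrm{d}m_x(y)=\mathrm{d}\nu(y)\,\mathrm{d}m_y(x)$.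 The spread at $x$ is $\sigma(x):=\left(\frac12\iint d(y,z)^2\,\mathrm{d}m_x(y)\,\mathrm{d}m_x(z)\right)^{1/2}$, and $\sigma:=\|\sigma(x)\|_{L^2(X,\nu)}$. The averaging operator is $Mf(x):=\int f(y)\,\mathrm{d}m_x(y)$ and the Laplacian is $\Delta:=M-\mathrm{Id}$. The space $L^2(X,\nu)/\{\mathrm{const}\}$ carries the norm $\|f\|^2:=\|f-\int f\,\mathrm{d}\nu\|^2_{L^2(X,\nu)}=\mathrm{Var}_\nu f$. *)

theory Defs
  imports "HOL-Probability.Probability"
begin

text \<open>The type class \<open>polish_space\<close> fixes a complete separable metric \<open>dist\<close>, so the metric space
  \<open>(X,d)\<close> is a type with its library metric and \<open>borel\<close> sets.\<close>

definition random_walk :: "('a::polish_space \<Rightarrow> 'a measure) \<Rightarrow> bool" where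
  "random_walk m \<longleftrightarrow>
     m \<in> borel \<rightarrow>\<^sub>M prob_algebra borel \<and>
     (\<forall>x p. (\<integral>\<^sup>+y. ennreal (dist p y) \<partial>m x) < \<infinity>)"

definition couplings :: "'a::polish_space measure \<Rightarrow> 'a measure \<Rightarrow> ('a \<times> 'a) measure set" where
  "couplings \<mu> \<nu> = {\<xi>. sets \<xi> = sets borel \<and> distr \<xi> borel fst = \<mu> \<and> distr \<xi> borel snd = \<nu>}"

definition transport_dist :: "'a::polish_space measure \<Rightarrow> 'a measure \<Rightarrow> ennreal" where
  "transport_dist \<mu> \<nu> = (INF \<xi>\<in>couplings \<mu> \<nu>. \<integral>\<^sup>+z. ennreal (dist (fst z) (snd z)) \<partial>\<xi>)"

definition ricci_curvature :: "('a::polish_space \<Rightarrow> 'a measure) \<Rightarrow> 'a \<Rightarrow> 'a \<Rightarrow> ereal" where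
  "ricci_curvature m x y = 1 - enn2ereal (transport_dist (m x) (m y)) / ereal (dist x y)"

definition ricci_curvature_at_least :: "('a::polish_space \<Rightarrow> 'a measure) \<Rightarrow> real \<Rightarrow> bool" where
  "ricci_curvature_at_least m \<kappa> \<longleftrightarrow> (\<forall>x y. x \<noteq> y \<longrightarrow> ereal \<kappa> \<le> ricci_curvature m x y)"

definition invariant_distribution :: "('a::polish_space \<Rightarrow> 'a measure) \<Rightarrow> 'a measure \<Rightarrow> bool" where
  "invariant_distribution m \<nu> \<longleftrightarrow> \<nu> \<in> space (prob_algebra borel) \<and> \<nu> \<bind> m = \<nu>"

text \<open>Equality, as measures on \<open>X \<times> X\<close>, of \<open>d\<nu>(x) dm\<^sub>x(y)\<close> and \<open>d\<nu>(y) dm\<^sub>y(x)\<close>.\<close>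

definition reversible_distribution :: "('a::polish_space \<Rightarrow> 'a measure) \<Rightarrow> 'a measure \<Rightarrow> bool" where
  "reversible_distribution m \<nu> \<longleftrightarrow>
     invariant_distribution m \<nu> \<and>
     \<nu> \<bind> (\<lambda>x. m x \<bind> (\<lambda>y. return borel (x, y))) =
     \<nu> \<bind> (\<lambda>y. m y \<bind> (\<lambda>x. return borel (x, y)))"

text \<open>Ergodicity with respect to an invariant distribution \<open>\<nu>\<close>: almost surely invariant sets are
  \<open>\<nu>\<close>-trivial.\<close>

definition ergodic_walk :: "('a::polish_space \<Rightarrow> 'a measure) \<Rightarrow> 'a measure \<Rightarrow> bool" where
  "ergodic_walk m \<nu> \<longleftrightarrow>
     (\<forall>A\<in>sets borel. (AE x in \<nu>. measure (m x) A = indicator A x) \<longrightarrow> measure \<nu> A \<in> {0, 1})"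

definition ennreal_root2 :: "ennreal \<Rightarrow> ennreal" where
  "ennreal_root2 t = (if t = \<infinity> then \<infinity> else ennreal (sqrt (enn2real t)))"

definition spread_at :: "('a::polish_space \<Rightarrow> 'a measure) \<Rightarrow> 'a \<Rightarrow> ennreal" where
  "spread_at m x =
     ennreal_root2 (ennreal (1/2) * (\<integral>\<^sup>+z. \<integral>\<^sup>+y. ennreal ((dist y z)\<^sup>2) \<partial>m x \<partial>m x))"

definition spread :: "('a::polish_space \<Rightarrow> 'a measure) \<Rightarrow> 'a measure \<Rightarrow> ennreal" where
  "spread m \<nu> = ennreal_root2 (\<integral>\<^sup>+x. (spread_at m x)\<^sup>2 \<partial>\<nu>)"

definition averaging :: "('a::polish_space \<Rightarrow> 'a measure) \<Rightarrow> ('a \<Rightarrow> real) \<Rightarrow> 'a \<Rightarrow> real" where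
  "averaging m f x = (\<integral>y. f y \<partial>m x)"

definition laplacian :: "('a::polish_space \<Rightarrow> 'a measure) \<Rightarrow> ('a \<Rightarrow> real) \<Rightarrow> 'a \<Rightarrow> real" where
  "laplacian m f x = averaging m f x - f x"

definition Var :: "'a measure \<Rightarrow> ('a \<Rightarrow> real) \<Rightarrow> real" where
  "Var \<mu> f = (\<integral>x. (f x - (\<integral>y. f y \<partial>\<mu>))\<^sup>2 \<partial>\<mu>)"

definition L2 :: "'a measure \<Rightarrow> ('a \<Rightarrow> real) set" where
  "L2 \<mu> = {f \<in> borel_measurable \<mu>. integrable \<mu> (\<lambda>x. (f x)\<^sup>2)}"

text \<open>Elements of \<open>L\<^sup>2(\<nu>)/{const}\<close> are handled through representatives in \<open>L2 \<nu>\<close>, and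
  \<open>eq_mod_const \<nu>\<close> is equality of the classes. An operator on the quotient is given by a map on
  representatives.\<close>

definition eq_mod_const :: "'a measure \<Rightarrow> ('a \<Rightarrow> real) \<Rightarrow> ('a \<Rightarrow> real) \<Rightarrow> bool" where
  "eq_mod_const \<nu> f g \<longleftrightarrow> (\<exists>c. AE x in \<nu>. f x = g x + c)"

definition eigenvalue_mod_const ::
  "'a measure \<Rightarrow> (('a \<Rightarrow> real) \<Rightarrow> 'a \<Rightarrow> real) \<Rightarrow> real \<Rightarrow> bool" where
  "eigenvalue_mod_const \<nu> T l \<longleftrightarrow>
     (\<exists>f\<in>L2 \<nu>. \<not> eq_mod_const \<nu> f (\<lambda>_. 0) \<and> eq_mod_const \<nu> (T f) (\<lambda>x. l * f x))"

text \<open>The real \<open>l\<close> for which \<open>T - l\<close> is not a bijection of \<open>L\<^sup>2(\<nu>)/{const}\<close>. For bounded \<open>T\<close> the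
  inverse of a bijective \<open>T - l\<close> is automatically bounded. For self-adjoint \<open>T\<close>, such as the
  Laplacian of a reversible walk, there is no non-real spectrum.\<close>

definition spectrum_mod_const ::
  "'a measure \<Rightarrow> (('a \<Rightarrow> real) \<Rightarrow> 'a \<Rightarrow> real) \<Rightarrow> real set" where
  "spectrum_mod_const \<nu> T =
     {l. \<not> ((\<forall>f\<in>L2 \<nu>. \<forall>g\<in>L2 \<nu>.
                eq_mod_const \<nu> (\<lambda>x. T f x - l * f x) (\<lambda>x. T g x - l * g x) \<longrightarrow>
                eq_mod_const \<nu> f g) \<and>
            (\<forall>g\<in>L2 \<nu>. \<exists>f\<in>L2 \<nu>. eq_mod_const \<nu> (\<lambda>x. T f x - l * f x) g))}"

end

theory Submission
  imports Defs
begin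

text \<open>Put \<open>c = 1 - \<kappa>\<close>. By transport duality \<open>M\<close> maps \<open>L\<close>-Lipschitz functions to \<open>c L\<close>-Lipschitz
  functions. Let \<open>h\<close> be bounded, Lipschitz and centered, and \<open>a\<^sub>n = Var (M\<^sup>n h)\<close>.
  The differences \<open>a\<^sub>n - a\<^sub>n\<^sub>+\<^sub>1 = \<integral>Var\<^bsub>m\<^sub>x\<^esub> (M\<^sup>n h) d\<nu>\<close> are at most
  \<open>(c\<^sup>n L)\<^sup>2 \<sigma>\<^sup>2\<close> and \<open>a\<^sub>n\<close> tends to \<open>0\<close>, so \<open>a\<^sub>n\<close> decays like \<open>c\<^sup>2\<^sup>n\<close>.
  Reversibility makes \<open>a\<close> log-convex, which upgrades this asymptotic rate to \<open>a\<^sub>1 \<le> c\<^sup>2 a\<^sub>0\<close>.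
  Bounded Lipschitz functions are dense in \<open>L\<^sup>2(\<nu>)\<close>, so \<open>M\<close> has norm at most \<open>c\<close> modulo constants.
  The Poincare inequalities follow from \<open>Var f = \<integral>Var\<^bsub>m\<^sub>x\<^esub> f d\<nu> + Var (M f)\<close> and from
  the Cauchy-Schwarz inequality for \<open>\<langle>f, M f\<rangle>\<close>. For \<open>l < \<kappa>\<close> the operator \<open>(1 - l) - M\<close> is
  inverted by a Neumann series.\<close>

subsection \<open>Square integrable functions and variance\<close>

context finite_measure
begin

lemma L2_integrable: "f \<in> L2 M \<Longrightarrow> integrable M f"
  by (auto simp: L2_def intro: square_integrable_imp_integrable)

lemma L2_mult_integrable:
  assumes "f \<in> L2 M" "g \<in> L2 M"
  shows "integrable M (\<lambda>x. f x * g x)"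
proof (rule Bochner_Integration.integrable_bound)
  show "integrable M (\<lambda>x. (f x)\<^sup>2 + (g x)\<^sup>2)"
    using assms by (auto simp: L2_def)
  show "(\<lambda>x. f x * g x) \<in> borel_measurable M"
    using assms by (auto simp: L2_def)
  have "\<bar>a * b\<bar> \<le> a\<^sup>2 + b\<^sup>2" for a b :: real
    using sum_squares_bound[of "\<bar>a\<bar>" "\<bar>b\<bar>"] mult_nonneg_nonneg[of "\<bar>a\<bar>" "\<bar>b\<bar>"]
    unfolding abs_mult power2_abs by linarith
  then show "AE x in M. norm (f x * g x) \<le> norm ((f x)\<^sup>2 + (g x)\<^sup>2)"
    by simp
qed

lemma L2_scale:
  assumes "f \<in> L2 M"
  shows "(\<lambda>x. a * f x) \<in> L2 M"
  using assms by (auto simp: L2_def power_mult_distrib)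

lemma L2_add:
  assumes "f \<in> L2 M" "g \<in> L2 M"
  shows "(\<lambda>x. f x + g x) \<in> L2 M"
  using assms L2_mult_integrable[OF assms] by (auto simp: L2_def power2_sum mult.assoc)

lemma L2_diff:
  assumes "f \<in> L2 M" "g \<in> L2 M"
  shows "(\<lambda>x. f x - g x) \<in> L2 M"
  using L2_add[OF assms(1) L2_scale[OF assms(2), of "-1"]] by simp

lemma L2_bounded:
  fixes f :: "'a \<Rightarrow> real"
  assumes "f \<in> borel_measurable M" "\<And>x. \<bar>f x\<bar> \<le> B"
  shows "f \<in> L2 M"
proof -
  have "(f x)\<^sup>2 \<le> B\<^sup>2" for x
    using power_mono[OF assms(2)[of x], of 2] by simp
  then show ?thesis
    using assms(1) by (auto simp: L2_def intro!: integrable_const_bound[where B="B\<^sup>2"])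
qed

lemma L2_const: "(\<lambda>_. c) \<in> L2 M"
  by (rule L2_bounded[where B="\<bar>c\<bar>"]) auto

lemma L2_dominated:
  assumes "f \<in> L2 M" "g \<in> borel_measurable M" "AE x in M. \<bar>g x\<bar> \<le> \<bar>f x\<bar>"
  shows "g \<in> L2 M"
proof -
  have "integrable M (\<lambda>x. (g x)\<^sup>2)"
    by (rule Bochner_Integration.integrable_bound[where f="\<lambda>x. (f x)\<^sup>2"])
       (use assms in \<open>auto simp: L2_def abs_le_square_iff\<close>)
  then show ?thesis using assms by (auto simp: L2_def)
qed

text \<open>Pointwise weighted AM-GM: with the two norms \<open>A\<close> and \<open>B\<close>,
  \<open>|f g|\<close> is at most \<open>(B / (2 * A)) f^2 + (A / (2 * B)) g^2\<close>, whose
  integral is exactly \<open>A * B\<close>. The weights divide by the norms, so a vanishing norm is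
  treated apart: that function is zero almost everywhere.\<close>

lemma L2_cauchy_schwarz:
  assumes f: "f \<in> L2 M" and g: "g \<in> L2 M"
  shows "\<bar>\<integral>x. f x * g x \<partial>M\<bar> \<le> sqrt (\<integral>x. (f x)\<^sup>2 \<partial>M) * sqrt (\<integral>x. (g x)\<^sup>2 \<partial>M)"
proof -
  have aux: "(\<integral>x. f x * g x \<partial>M) = 0" if "(\<integral>x. (f x)\<^sup>2 \<partial>M) = 0" "f \<in> L2 M" for f g
  proof -
    have "AE x in M. (f x)\<^sup>2 = 0"
      using that by (subst (asm) integral_nonneg_eq_0_iff_AE) (auto simp: L2_def)
    then have "AE x in M. f x * g x = 0" by auto
    then show ?thesis by (rule integral_eq_zero_AE)
  qed
  define A B where "A = sqrt (\<integral>x. (f x)\<^sup>2 \<partial>M)" and "B = sqrt (\<integral>x. (g x)\<^sup>2 \<partial>M)"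
  have A2: "A\<^sup>2 = (\<integral>x. (f x)\<^sup>2 \<partial>M)" and B2: "B\<^sup>2 = (\<integral>x. (g x)\<^sup>2 \<partial>M)"
    and "A \<ge> 0" "B \<ge> 0"
    by (simp_all add: A_def B_def)
  consider "A = 0" | "B = 0" | "A > 0" "B > 0"
    using \<open>A \<ge> 0\<close> \<open>B \<ge> 0\<close> by linarith
  then show ?thesis
  proof cases
    case 1
    then show ?thesis using aux[of f g] f by (simp add: A_def)
  next
    case 2
    then show ?thesis using aux[of g f] g by (simp add: B_def mult.commute)
  next
    case 3
    have "\<bar>\<integral>x. f x * g x \<partial>M\<bar> \<le> (\<integral>x. \<bar>f x * g x\<bar> \<partial>M)"
      by (rule integral_abs_bound)
    also have "\<dots> \<le> (\<integral>x. (B / (2 * A)) * (f x)\<^sup>2 + (A / (2 * B)) * (g x)\<^sup>2 \<partial>M)"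
    proof (rule integral_mono)
      show "integrable M (\<lambda>x. \<bar>f x * g x\<bar>)"
        using L2_mult_integrable[OF f g] by simp
      show "integrable M (\<lambda>x. (B / (2 * A)) * (f x)\<^sup>2 + (A / (2 * B)) * (g x)\<^sup>2)"
        using f g by (auto simp: L2_def)
      fix x
      have "0 \<le> (B * \<bar>f x\<bar> - A * \<bar>g x\<bar>)\<^sup>2 / (2 * A * B)"
        using 3 by (intro divide_nonneg_pos) auto
      also have "\<dots> = (B / (2 * A)) * (f x)\<^sup>2 + (A / (2 * B)) * (g x)\<^sup>2 - \<bar>f x * g x\<bar>"
        using 3 by (simp add: field_simps power2_eq_square abs_mult)
      finally show "\<bar>f x * g x\<bar> \<le> (B / (2 * A)) * (f x)\<^sup>2 + (A / (2 * B)) * (g x)\<^sup>2"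
        by simp
    qed
    also have "\<dots> = (B / (2 * A)) * A\<^sup>2 + (A / (2 * B)) * B\<^sup>2"
      unfolding A2 B2 using f g by (subst Bochner_Integration.integral_add) (auto simp: L2_def)
    also have "\<dots> = A * B"
      using 3 by (simp add: field_simps power2_eq_square)
    finally show ?thesis by (simp add: A_def B_def)
  qed
qed

lemma L2_norm_triangle:
  assumes f: "f \<in> L2 M" and g: "g \<in> L2 M"
  shows "sqrt (\<integral>x. (f x + g x)\<^sup>2 \<partial>M) \<le> sqrt (\<integral>x. (f x)\<^sup>2 \<partial>M) + sqrt (\<integral>x. (g x)\<^sup>2 \<partial>M)"
proof (rule real_le_lsqrt)
  have "(\<integral>x. (f x + g x)\<^sup>2 \<partial>M)
      = (\<integral>x. (f x)\<^sup>2 \<partial>M) + 2 * (\<integral>x. f x * g x \<partial>M) + (\<integral>x. (g x)\<^sup>2 \<partial>M)"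
    using f g L2_mult_integrable[OF f g] by (simp add: power2_sum L2_def mult.assoc)
  also have "\<dots> \<le> (sqrt (\<integral>x. (f x)\<^sup>2 \<partial>M) + sqrt (\<integral>x. (g x)\<^sup>2 \<partial>M))\<^sup>2"
    using L2_cauchy_schwarz[OF f g] by (simp add: power2_sum)
  finally show "(\<integral>x. (f x + g x)\<^sup>2 \<partial>M)
    \<le> (sqrt (\<integral>x. (f x)\<^sup>2 \<partial>M) + sqrt (\<integral>x. (g x)\<^sup>2 \<partial>M))\<^sup>2" .
qed simp_all

end

section \<open>Variance as a squared seminorm modulo constants\<close>

lemma Var_nonneg: "0 \<le> Var \<mu> f"
  by (simp add: Var_def)

lemma Var_cong_AE:
  assumes "AE x in \<mu>. f x = g x" "f \<in> borel_measurable \<mu>" "g \<in> borel_measurable \<mu>"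
  shows "Var \<mu> f = Var \<mu> g"
proof -
  have "(\<integral>x. f x \<partial>\<mu>) = (\<integral>x. g x \<partial>\<mu>)"
    using assms by (intro integral_cong_AE) auto
  then show ?thesis
    unfolding Var_def using assms by (intro integral_cong_AE) auto
qed

context prob_space
begin

lemma Var_eq:
  assumes "f \<in> L2 M"
  shows "Var M f = (\<integral>x. (f x)\<^sup>2 \<partial>M) - (\<integral>x. f x \<partial>M)\<^sup>2"
  using assms L2_integrable[OF assms] unfolding Var_def by (intro variance_eq) (auto simp: L2_def)

lemma Var_add_const:
  assumes "integrable M f"
  shows "Var M (\<lambda>x. f x + c) = Var M f"
  using assms by (simp add: Var_def prob_space)

lemma Var_scale: "Var M (\<lambda>x. a * f x) = a\<^sup>2 * Var M f"
  by (simp add: Var_def flip: right_diff_distrib) (simp add: power_mult_distrib)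

text \<open>The mean is the best constant. This permits replacing the unknown mean by any convenient
  value, later a value of the function at a fixed point.\<close>

lemma Var_le_second_moment:
  assumes "f \<in> L2 M"
  shows "Var M f \<le> (\<integral>x. (f x - c)\<^sup>2 \<partial>M)"
proof -
  have "Var M f = Var M (\<lambda>x. f x - c)"
    using Var_add_const[OF L2_integrable[OF assms], of "-c"] by simp
  also have "\<dots> \<le> (\<integral>x. (f x - c)\<^sup>2 \<partial>M)"
    by (subst Var_eq) (auto intro!: L2_diff assms L2_const)
  finally show ?thesis .
qed

lemma centered_L2:
  assumes "f \<in> L2 M"
  shows "(\<lambda>x. f x - (\<integral>y. f y \<partial>M)) \<in> L2 M"
  by (intro L2_diff assms L2_const)

lemma Var_triangle:
  assumes f: "f \<in> L2 M" and g: "g \<in> L2 M"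
  shows "sqrt (Var M (\<lambda>x. f x + g x)) \<le> sqrt (Var M f) + sqrt (Var M g)"
proof -
  have "Var M (\<lambda>x. f x + g x)
      = (\<integral>x. ((f x - (\<integral>y. f y \<partial>M)) + (g x - (\<integral>y. g y \<partial>M)))\<^sup>2 \<partial>M)"
    unfolding Var_def using L2_integrable[OF f] L2_integrable[OF g]
    by (simp add: algebra_simps)
  then show ?thesis
    using L2_norm_triangle[OF centered_L2[OF f] centered_L2[OF g]] by (simp add: Var_def)
qed

lemma Var_eq_0_imp_AE:
  assumes f: "f \<in> L2 M" and "Var M f = 0"
  shows "AE x in M. f x = (\<integral>y. f y \<partial>M)"
proof -
  have "AE x in M. (f x - (\<integral>y. f y \<partial>M))\<^sup>2 = 0"
    using assms centered_L2[OF f] unfolding Var_def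
    by (subst (asm) integral_nonneg_eq_0_iff_AE) (auto simp: L2_def)
  then show ?thesis by eventually_elim simp
qed

lemma integral_quadratic:
  fixes f :: "'a \<Rightarrow> real"
  assumes f: "f \<in> L2 M"
  shows "(\<integral>x. (f x)\<^sup>2 + b * f x + c \<partial>M) = (\<integral>x. (f x)\<^sup>2 \<partial>M) + b * (\<integral>x. f x \<partial>M) + c"
proof -
  have "integrable M (\<lambda>x. (f x)\<^sup>2)" "integrable M (\<lambda>x. b * f x)"
    using f L2_integrable[OF f] by (auto simp: L2_def)
  then show ?thesis by (simp add: prob_space)
qed

text \<open>Connects variance with the double integral in \<open>spread_at\<close>; the factor 2 is
  what the \<open>1/2\<close> in the spread cancels.\<close>

lemma Var_double_integral:
  assumes f: "f \<in> L2 M"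
  shows "(\<integral>z. (\<integral>y. (f y - f z)\<^sup>2 \<partial>M) \<partial>M) = 2 * Var M f"
proof -
  define A B where "A = (\<integral>x. (f x)\<^sup>2 \<partial>M)" and "B = (\<integral>x. f x \<partial>M)"
  have inner: "(\<integral>y. (f y - f z)\<^sup>2 \<partial>M) = (f z)\<^sup>2 + (- 2 * B) * f z + A" for z
  proof -
    have "(\<integral>y. (f y - f z)\<^sup>2 \<partial>M) = (\<integral>y. (f y)\<^sup>2 + (- 2 * f z) * f y + (f z)\<^sup>2 \<partial>M)"
      by (rule Bochner_Integration.integral_cong) (simp_all add: power2_diff)
    also have "\<dots> = A + (- 2 * f z) * B + (f z)\<^sup>2"
      unfolding A_def B_def by (rule integral_quadratic[OF f])
    finally show ?thesis by (simp only: algebra_simps)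
  qed
  have "(\<integral>z. (\<integral>y. (f y - f z)\<^sup>2 \<partial>M) \<partial>M) = A + (- 2 * B) * B + A"
    unfolding inner integral_quadratic[OF f] A_def[symmetric] B_def[symmetric] ..
  also have "\<dots> = 2 * (A - B\<^sup>2)"
    by (simp add: power2_eq_square)
  also have "A - B\<^sup>2 = Var M f"
    unfolding A_def B_def by (rule Var_eq[OF f, symmetric])
  finally show ?thesis .
qed

end

subsection \<open>Kernels with an invariant distribution\<close>

text \<open>Pushing \<open>L x\<close> forward along \<open>y \<mapsto> (x, y)\<close> gives a
  kernel into the product space, so an integrand depending on the parameter becomes one fixed
  integrand.\<close>

lemma integral_measurable_subprob_algebra2:
  fixes f :: "'a \<Rightarrow> 'b \<Rightarrow> real"
  assumes f [measurable]: "(\<lambda>(x, y). f x y) \<in> borel_measurable (M \<Otimes>\<^sub>M N)"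
    and L [measurable]: "L \<in> M \<rightarrow>\<^sub>M subprob_algebra N"
  shows "(\<lambda>x. \<integral>y. f x y \<partial>L x) \<in> borel_measurable M"
proof -
  have "(\<lambda>x. distr (L x) (M \<Otimes>\<^sub>M N) (\<lambda>y. (x, y))) \<in> M \<rightarrow>\<^sub>M subprob_algebra (M \<Otimes>\<^sub>M N)"
    by (rule measurable_distr2[OF _ L]) simp
  from measurable_compose[OF this integral_measurable_subprob_algebra[OF f]]
  show ?thesis
  proof (rule measurable_cong[THEN iffD1, rotated])
    fix x assume x: "x \<in> space M"
    then have [measurable_cong]: "sets (L x) = sets N"
      by (rule sets_kernel[OF L])
    show "(\<integral>z. (case z of (x, y) \<Rightarrow> f x y) \<partial>distr (L x) (M \<Otimes>\<^sub>M N) (\<lambda>y. (x, y))) = (\<integral>y. f x y \<partial>L x)"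
      using x by (subst integral_distr) (auto intro!: measurable_Pair1')
  qed
qed

text \<open>Shared by the curved case and by the one-point case of the final theorem, where
  \<open>1 - \<kappa>\<close> may be negative and \<open>curved_walk\<close> is out of
  reach.\<close>

locale invariant_kernel =
  fixes m :: "'a::polish_space \<Rightarrow> 'a measure" and \<nu> :: "'a measure"
  assumes kernel: "m \<in> borel \<rightarrow>\<^sub>M prob_algebra borel"
    and nu: "\<nu> \<in> space (prob_algebra borel)"
    and invariant: "\<nu> \<bind> m = \<nu>"
begin

lemma sets_nu [measurable_cong]: "sets \<nu> = sets borel"
  using nu by (simp add: space_prob_algebra)

lemma space_nu [simp]: "space \<nu> = UNIV"
  using sets_eq_imp_space_eq[OF sets_nu] by simp

lemma measurable_nu [simp]: "borel_measurable \<nu> = borel_measurable borel"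
  by (rule measurable_cong_sets[OF sets_nu refl])

lemma sets_kernel_borel [measurable_cong]: "sets (m x) = sets borel"
  using measurable_space[OF kernel, of x] by (simp add: space_prob_algebra)

lemma measurable_kernel_borel [simp]: "borel_measurable (m x) = borel_measurable borel"
  by (rule measurable_cong_sets[OF sets_kernel_borel refl])

lemma prob_space_kernel: "prob_space (m x)"
  using measurable_space[OF kernel, of x] by (simp add: space_prob_algebra)

lemma kernel_subprob: "m \<in> \<nu> \<rightarrow>\<^sub>M subprob_algebra borel"
  using measurable_prob_algebraD[OF kernel] by (simp cong: measurable_cong_sets add: sets_nu)

sublocale prob_space \<nu>
  using nu by (simp add: space_prob_algebra)

sublocale K: prob_space "m x" for x
  by (rule prob_space_kernel)

lemma prob_UNIV: "prob UNIV = 1"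
  using prob_space by simp

lemma averaging_measurable [measurable]:
  assumes "f \<in> borel_measurable borel"
  shows "averaging m f \<in> borel_measurable borel"
proof -
  have "(\<lambda>x. integral\<^sup>L (m x) f) \<in> borel_measurable borel"
    by (rule measurable_compose[OF measurable_prob_algebraD[OF kernel]
          integral_measurable_subprob_algebra[OF assms]])
  then show ?thesis by (simp add: averaging_def[abs_def])
qed

lemma nn_integral_invariant:
  assumes "g \<in> borel_measurable borel"
  shows "(\<integral>\<^sup>+x. \<integral>\<^sup>+y. g y \<partial>m x \<partial>\<nu>) = (\<integral>\<^sup>+x. g x \<partial>\<nu>)"
  using nn_integral_bind[OF assms kernel_subprob] by (simp add: invariant)

text \<open>By invariance the function \<open>x \<mapsto> \<integral>|f| dm_x\<close> has the finite
  \<open>\<nu>\<close>-integral \<open>\<integral>|f| d\<nu>\<close>, hence is finite almost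
  everywhere.\<close>

lemma AE_kernel_integrable:
  assumes f: "integrable \<nu> (f :: 'a \<Rightarrow> real)"
  shows "AE x in \<nu>. integrable (m x) f"
proof -
  have [measurable]: "f \<in> borel_measurable borel"
    using borel_measurable_integrable[OF f] by simp
  have meas: "(\<lambda>x. \<integral>\<^sup>+y. ennreal (norm (f y)) \<partial>m x) \<in> borel_measurable \<nu>"
    by (rule measurable_compose[OF kernel_subprob nn_integral_measurable_subprob_algebra]) simp
  have "(\<integral>\<^sup>+x. \<integral>\<^sup>+y. ennreal (norm (f y)) \<partial>m x \<partial>\<nu>) \<noteq> \<infinity>"
    using f by (subst nn_integral_invariant) (auto simp: integrable_iff_bounded)
  from nn_integral_PInf_AE[OF meas this]
  show ?thesis
    by eventually_elim (auto simp: integrable_iff_bounded less_top)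
qed

lemma averaging_invariant_nonneg:
  assumes f: "integrable \<nu> (f :: 'a \<Rightarrow> real)" and nonneg: "\<And>x. 0 \<le> f x"
  shows "has_bochner_integral \<nu> (averaging m f) (\<integral>x. f x \<partial>\<nu>)"
proof (rule has_bochner_integral_nn_integral)
  have [measurable]: "f \<in> borel_measurable borel"
    using borel_measurable_integrable[OF f] by simp
  show "averaging m f \<in> borel_measurable \<nu>" by simp
  show "AE x in \<nu>. 0 \<le> averaging m f x" by (simp add: averaging_def nonneg)
  show "0 \<le> (\<integral>x. f x \<partial>\<nu>)" by (simp add: nonneg)
  have "(\<integral>\<^sup>+x. ennreal (averaging m f x) \<partial>\<nu>) = (\<integral>\<^sup>+x. \<integral>\<^sup>+y. ennreal (f y) \<partial>m x \<partial>\<nu>)"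
  proof (rule nn_integral_cong_AE)
    show "AE x in \<nu>. ennreal (averaging m f x) = (\<integral>\<^sup>+y. ennreal (f y) \<partial>m x)"
      using AE_kernel_integrable[OF f]
      by eventually_elim (simp add: averaging_def nn_integral_eq_integral nonneg)
  qed
  also have "\<dots> = (\<integral>\<^sup>+x. ennreal (f x) \<partial>\<nu>)"
    by (rule nn_integral_invariant) simp
  also have "\<dots> = ennreal (\<integral>x. f x \<partial>\<nu>)"
    by (rule nn_integral_eq_integral) (auto simp: f nonneg)
  finally show "(\<integral>\<^sup>+x. ennreal (averaging m f x) \<partial>\<nu>) = ennreal (\<integral>x. f x \<partial>\<nu>)" .
qed

text \<open>Only almost everywhere: where \<open>f\<close> or \<open>g\<close> is not integrable for
  \<open>m x\<close>, its integral takes the default value 0 and additivity may fail.\<close>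

lemma averaging_linear_AE:
  assumes f: "integrable \<nu> f" and g: "integrable \<nu> g"
  shows "AE x in \<nu>. averaging m (\<lambda>x. a * f x + b * g x) x = a * averaging m f x + b * averaging m g x"
  using AE_kernel_integrable[OF f] AE_kernel_integrable[OF g]
  by eventually_elim (simp add: averaging_def)

lemma averaging_invariant:
  assumes f: "integrable \<nu> (f :: 'a \<Rightarrow> real)"
  shows "has_bochner_integral \<nu> (averaging m f) (\<integral>x. f x \<partial>\<nu>)"
proof -
  \<comment> \<open>Positive and negative part reduce the claim to the nonnegative case, which is
    read off from \<open>nn_integral_invariant\<close>.\<close>
  let ?p = "\<lambda>x. max 0 (f x)" and ?n = "\<lambda>x. max 0 (- f x)"
  have [measurable]: "f \<in> borel_measurable borel"
    using borel_measurable_integrable[OF f] by simp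
  have int: "integrable \<nu> ?p" "integrable \<nu> ?n"
    using f by auto
  have "has_bochner_integral \<nu> (\<lambda>x. averaging m ?p x - averaging m ?n x) ((\<integral>x. ?p x \<partial>\<nu>) - (\<integral>x. ?n x \<partial>\<nu>))"
    by (intro has_bochner_integral_diff averaging_invariant_nonneg int) auto
  moreover have "(\<integral>x. ?p x \<partial>\<nu>) - (\<integral>x. ?n x \<partial>\<nu>) = (\<integral>x. f x \<partial>\<nu>)"
    unfolding Bochner_Integration.integral_diff[OF int, symmetric]
    by (rule Bochner_Integration.integral_cong) auto
  moreover have "AE x in \<nu>. averaging m ?p x - averaging m ?n x = averaging m f x"
  proof -
    have eq: "(\<lambda>x. 1 * ?p x + (- 1) * ?n x) = f" by (auto simp: fun_eq_iff)
    show ?thesis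
      using averaging_linear_AE[OF int, of 1 "-1", unfolded eq] by eventually_elim simp
  qed
  ultimately show ?thesis
    by (subst (asm) has_bochner_integral_cong_AE) auto
qed

lemmas integrable_averaging = averaging_invariant[THEN integrable.intros]
lemmas integral_averaging = averaging_invariant[THEN has_bochner_integral_integral_eq]

lemma AE_kernel_L2:
  assumes "f \<in> L2 \<nu>"
  shows "AE x in \<nu>. f \<in> L2 (m x)"
proof -
  have "integrable \<nu> (\<lambda>x. (f x)\<^sup>2)" "f \<in> borel_measurable borel"
    using assms by (auto simp: L2_def)
  with AE_kernel_integrable[OF this(1)] show ?thesis
    by (auto simp: L2_def)
qed

lemma Var_kernel_AE:
  assumes "f \<in> L2 \<nu>"
  shows "AE x in \<nu>. Var (m x) f = averaging m (\<lambda>x. (f x)\<^sup>2) x - (averaging m f x)\<^sup>2"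
  using AE_kernel_L2[OF assms] by eventually_elim (simp add: averaging_def K.Var_eq)

text \<open>Jensen's inequality in the form that the variance under \<open>m x\<close> is
  nonnegative: \<open>(M f)^2 \<le> M (f^2)\<close> almost everywhere, and the right side is
  integrable by invariance.\<close>

lemma averaging_L2:
  assumes f: "f \<in> L2 \<nu>"
  shows "averaging m f \<in> L2 \<nu>"
proof -
  have [measurable]: "f \<in> borel_measurable borel" and sq: "integrable \<nu> (\<lambda>x. (f x)\<^sup>2)"
    using f by (auto simp: L2_def)
  have "integrable \<nu> (\<lambda>x. (averaging m f x)\<^sup>2)"
  proof (rule Bochner_Integration.integrable_bound[OF integrable_averaging[OF sq]])
    show "AE x in \<nu>. norm ((averaging m f x)\<^sup>2) \<le> norm (averaging m (\<lambda>x. (f x)\<^sup>2) x)"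
      using Var_kernel_AE[OF f]
    proof eventually_elim
      case (elim x)
      then show ?case using Var_nonneg[of "m x" f] by simp
    qed
  qed simp
  then show ?thesis by (simp add: L2_def)
qed

text \<open>The law of total variance. Integrating \<open>M (f^2) - (M f)^2\<close>, invariance
  removes \<open>M\<close> from the first term, and the squared means cancel because
  \<open>f\<close> and \<open>M f\<close> have equal mean.\<close>

lemma integral_Var_kernel:
  assumes f: "f \<in> L2 \<nu>"
  shows "(\<integral>x. Var (m x) f \<partial>\<nu>) = Var \<nu> f - Var \<nu> (averaging m f)"
proof -
  have [measurable]: "f \<in> borel_measurable borel" and sq: "integrable \<nu> (\<lambda>x. (f x)\<^sup>2)"
    using f by (auto simp: L2_def)
  have sq': "integrable \<nu> (\<lambda>x. (averaging m f x)\<^sup>2)"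
    using averaging_L2[OF f] by (auto simp: L2_def)
  have meas: "(\<lambda>x. Var (m x) f) \<in> borel_measurable \<nu>"
  proof -
    have "(\<lambda>(x, y). (f y - averaging m f x)\<^sup>2) \<in> borel_measurable (\<nu> \<Otimes>\<^sub>M borel)"
      by measurable
    from integral_measurable_subprob_algebra2[OF this kernel_subprob]
    show ?thesis by (simp add: Var_def averaging_def)
  qed
  have "(\<integral>x. Var (m x) f \<partial>\<nu>) = (\<integral>x. averaging m (\<lambda>x. (f x)\<^sup>2) x - (averaging m f x)\<^sup>2 \<partial>\<nu>)"
    using Var_kernel_AE[OF f] meas by (intro integral_cong_AE) auto
  also have "\<dots> = (\<integral>x. (f x)\<^sup>2 \<partial>\<nu>) - (\<integral>x. (averaging m f x)\<^sup>2 \<partial>\<nu>)"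
    using sq sq' by (simp add: integrable_averaging integral_averaging)
  also have "\<dots> = Var \<nu> f - Var \<nu> (averaging m f)"
    using f by (simp add: Var_eq averaging_L2 integral_averaging L2_integrable)
  finally show "(\<integral>x. Var (m x) f \<partial>\<nu>) = Var \<nu> f - Var \<nu> (averaging m f)" .
qed

lemma Var_averaging_le:
  assumes "f \<in> L2 \<nu>"
  shows "Var \<nu> (averaging m f) \<le> Var \<nu> f"
proof -
  have "0 \<le> (\<integral>x. Var (m x) f \<partial>\<nu>)" by (intro integral_nonneg_AE) (simp add: Var_nonneg)
  then show ?thesis using integral_Var_kernel[OF assms] by simp
qed

text \<open>Expand the square: by invariance \<open>f(y)^2\<close> and \<open>f(x)^2\<close>
  contribute equally, and the cross term is the pairing of \<open>f\<close> with \<open>M f\<close>.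
  This is the Dirichlet form.\<close>

lemma integral_gradient_sq:
  assumes f: "f \<in> L2 \<nu>"
  shows "(\<integral>x. (\<integral>y. (f y - f x)\<^sup>2 \<partial>m x) \<partial>\<nu>)
    = 2 * ((\<integral>x. (f x)\<^sup>2 \<partial>\<nu>) - (\<integral>x. f x * averaging m f x \<partial>\<nu>))"
proof -
  have [measurable]: "f \<in> borel_measurable borel" and sq: "integrable \<nu> (\<lambda>x. (f x)\<^sup>2)"
    using f by (auto simp: L2_def)
  have "(\<integral>x. (\<integral>y. (f y - f x)\<^sup>2 \<partial>m x) \<partial>\<nu>)
      = (\<integral>x. averaging m (\<lambda>x. (f x)\<^sup>2) x - 2 * (f x * averaging m f x) + (f x)\<^sup>2 \<partial>\<nu>)"
  proof (rule integral_cong_AE)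
    have "(\<lambda>(x, y). (f y - f x)\<^sup>2) \<in> borel_measurable (\<nu> \<Otimes>\<^sub>M borel)"
      by measurable
    from integral_measurable_subprob_algebra2[OF this kernel_subprob]
    show "(\<lambda>x. \<integral>y. (f y - f x)\<^sup>2 \<partial>m x) \<in> borel_measurable \<nu>" .
    show "AE x in \<nu>. (\<integral>y. (f y - f x)\<^sup>2 \<partial>m x)
        = averaging m (\<lambda>x. (f x)\<^sup>2) x - 2 * (f x * averaging m f x) + (f x)\<^sup>2"
      using AE_kernel_L2[OF f]
    proof eventually_elim
      case (elim x)
      then show ?case
        using K.L2_integrable[OF elim]
        by (simp add: power2_diff averaging_def L2_def K.prob_space)
    qed
  qed simp
  also have "\<dots> = 2 * ((\<integral>x. (f x)\<^sup>2 \<partial>\<nu>) - (\<integral>x. f x * averaging m f x \<partial>\<nu>))"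
    using sq L2_mult_integrable[OF f averaging_L2[OF f]]
    by (simp add: integrable_averaging integral_averaging)
  finally show ?thesis .
qed

end

subsection \<open>Density of bounded Lipschitz functions\<close>

text \<open>Membership in the \<open>L\<^sup>2\<close> closure of the bounded Lipschitz functions.
  Boundedness is demanded of the approximants because the transport and self-adjointness estimates
  are stated for bounded functions.\<close>

definition lipschitz_approximable :: "'a::metric_space measure \<Rightarrow> ('a \<Rightarrow> real) \<Rightarrow> bool" where
  "lipschitz_approximable M f \<longleftrightarrow> f \<in> L2 M \<and>
     (\<forall>e>0. \<exists>g L. L-lipschitz_on UNIV g \<and> bounded (range g) \<and> g \<in> L2 M \<and>
        sqrt (\<integral>x. (f x - g x)\<^sup>2 \<partial>M) < e)"

lemma (in finite_measure) L2_norm_diff_triangle: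
  assumes "f \<in> L2 M" "g \<in> L2 M" "h \<in> L2 M"
  shows "sqrt (\<integral>x. (f x - h x)\<^sup>2 \<partial>M) \<le> sqrt (\<integral>x. (f x - g x)\<^sup>2 \<partial>M) + sqrt (\<integral>x. (g x - h x)\<^sup>2 \<partial>M)"
  using L2_norm_triangle[OF L2_diff[OF assms(1,2)] L2_diff[OF assms(2,3)]] by simp

locale finite_borel_measure = finite_measure M for M :: "'a::polish_space measure" +
  assumes sets_M [measurable_cong]: "sets M = sets borel"
begin

lemma space_M [simp]: "space M = UNIV"
  using sets_eq_imp_space_eq[OF sets_M] by simp

lemma lipschitz_approximable_add:
  assumes f: "lipschitz_approximable M f" and g: "lipschitz_approximable M g"
  shows "lipschitz_approximable M (\<lambda>x. f x + g x)"
  unfolding lipschitz_approximable_def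
proof (intro conjI allI impI)
  show "(\<lambda>x. f x + g x) \<in> L2 M"
    using f g by (auto simp: lipschitz_approximable_def intro: L2_add)
  fix e :: real assume "e > 0"
  then have "e / 2 > 0" by simp
  from f this obtain f' K where f': "K-lipschitz_on UNIV f'" "bounded (range f')" "f' \<in> L2 M"
    "sqrt (\<integral>x. (f x - f' x)\<^sup>2 \<partial>M) < e / 2"
    unfolding lipschitz_approximable_def by blast
  from g \<open>e / 2 > 0\<close> obtain g' L where g': "L-lipschitz_on UNIV g'" "bounded (range g')" "g' \<in> L2 M"
    "sqrt (\<integral>x. (g x - g' x)\<^sup>2 \<partial>M) < e / 2"
    unfolding lipschitz_approximable_def by blast
  have "sqrt (\<integral>x. ((f x - f' x) + (g x - g' x))\<^sup>2 \<partial>M)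
      \<le> sqrt (\<integral>x. (f x - f' x)\<^sup>2 \<partial>M) + sqrt (\<integral>x. (g x - g' x)\<^sup>2 \<partial>M)"
    using f g f' g' by (intro L2_norm_triangle L2_diff) (auto simp: lipschitz_approximable_def)
  then have "sqrt (\<integral>x. (f x + g x - (f' x + g' x))\<^sup>2 \<partial>M) < e"
    using f'(4) g'(4) by (simp add: algebra_simps)
  then show "\<exists>h L. L-lipschitz_on UNIV h \<and> bounded (range h) \<and> h \<in> L2 M \<and>
      sqrt (\<integral>x. (f x + g x - h x)\<^sup>2 \<partial>M) < e"
    using f' g' by (intro exI[of _ "\<lambda>x. f' x + g' x"] exI[of _ "K + L"])
      (auto intro: L2_add lipschitz_on_add bounded_plus_comp)
qed

lemma lipschitz_approximable_scale:
  assumes f: "lipschitz_approximable M f"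
  shows "lipschitz_approximable M (\<lambda>x. a * f x)"
  unfolding lipschitz_approximable_def
proof (intro conjI allI impI)
  show "(\<lambda>x. a * f x) \<in> L2 M"
    using f by (auto simp: lipschitz_approximable_def intro: L2_scale)
  fix e :: real assume "e > 0"
  then have "e / (\<bar>a\<bar> + 1) > 0" by simp
  with f obtain g L where g: "L-lipschitz_on UNIV g" "bounded (range g)" "g \<in> L2 M"
    "sqrt (\<integral>x. (f x - g x)\<^sup>2 \<partial>M) < e / (\<bar>a\<bar> + 1)"
    unfolding lipschitz_approximable_def by blast
  have "(\<lambda>x. (a * f x - a * g x)\<^sup>2) = (\<lambda>x. a\<^sup>2 * (f x - g x)\<^sup>2)"
    by (simp add: power_mult_distrib flip: right_diff_distrib)
  then have "sqrt (\<integral>x. (a * f x - a * g x)\<^sup>2 \<partial>M) = \<bar>a\<bar> * sqrt (\<integral>x. (f x - g x)\<^sup>2 \<partial>M)"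
    by (simp add: real_sqrt_mult)
  also have "\<dots> \<le> \<bar>a\<bar> * (e / (\<bar>a\<bar> + 1))"
    using g(4) by (intro mult_left_mono) auto
  also have "\<dots> < e"
    using \<open>e > 0\<close> by (simp add: field_simps)
  finally show "\<exists>h L. L-lipschitz_on UNIV h \<and> bounded (range h) \<and> h \<in> L2 M \<and>
      sqrt (\<integral>x. (a * f x - h x)\<^sup>2 \<partial>M) < e"
    using g by (intro exI[of _ "\<lambda>x. a * g x"] exI[of _ "\<bar>a\<bar> * L"])
      (auto intro: L2_scale lipschitz_on_cmult_real bounded_scaleR_comp[where 'b=real, simplified])
qed

lemma lipschitz_approximable_lim:
  assumes f: "f \<in> L2 M"
    and approx: "\<And>e. e > 0 \<Longrightarrow> \<exists>h. lipschitz_approximable M h \<and> sqrt (\<integral>x. (f x - h x)\<^sup>2 \<partial>M) < e"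
  shows "lipschitz_approximable M f"
  unfolding lipschitz_approximable_def
proof (intro conjI allI impI f)
  fix e :: real assume "e > 0"
  then have "e / 2 > 0" by simp
  from approx[OF this] obtain h where h: "lipschitz_approximable M h"
    "sqrt (\<integral>x. (f x - h x)\<^sup>2 \<partial>M) < e / 2" by blast
  from h(1) \<open>e / 2 > 0\<close> obtain g L where g: "L-lipschitz_on UNIV g" "bounded (range g)" "g \<in> L2 M"
    "sqrt (\<integral>x. (h x - g x)\<^sup>2 \<partial>M) < e / 2"
    unfolding lipschitz_approximable_def by blast
  have "h \<in> L2 M" using h(1) by (simp add: lipschitz_approximable_def)
  from L2_norm_diff_triangle[OF f this g(3)] h(2) g
  show "\<exists>g L. L-lipschitz_on UNIV g \<and> bounded (range g) \<and> g \<in> L2 M \<and>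
      sqrt (\<integral>x. (f x - g x)\<^sup>2 \<partial>M) < e"
    by (intro exI[of _ g] exI[of _ L]) auto
qed

lemma lipschitz_approximable_lim_dominated:
  assumes f: "f \<in> L2 M" and s: "\<And>n. lipschitz_approximable M (s n)"
    and lim: "\<And>x. (\<lambda>n. s n x) \<longlonglongrightarrow> f x" and bound: "\<And>n x. \<bar>s n x\<bar> \<le> 2 * \<bar>f x\<bar>"
  shows "lipschitz_approximable M f"
proof (rule lipschitz_approximable_lim[OF f])
  have sL: "s n \<in> L2 M" for n using s by (auto simp: lipschitz_approximable_def)
  have [measurable]: "f \<in> borel_measurable M" "s n \<in> borel_measurable M" for n
    using f sL by (auto simp: L2_def)
  have "(\<lambda>n. \<integral>x. (f x - s n x)\<^sup>2 \<partial>M) \<longlonglongrightarrow> (\<integral>x. 0 \<partial>M)"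
  \<comment> \<open>The majorant comes from
    \<open>|f - s n| \<le> |f| + 2 |f| = 3 |f|\<close>.\<close>
  proof (rule integral_dominated_convergence[where w="\<lambda>x. 9 * (f x)\<^sup>2"])
    show "integrable M (\<lambda>x. 9 * (f x)\<^sup>2)" using f by (auto simp: L2_def)
    show "AE x in M. (\<lambda>n. (f x - s n x)\<^sup>2) \<longlonglongrightarrow> 0"
    proof (rule AE_I2)
      fix x
      have "(\<lambda>n. (f x - s n x)\<^sup>2) \<longlonglongrightarrow> (f x - f x)\<^sup>2"
        by (intro tendsto_intros lim)
      then show "(\<lambda>n. (f x - s n x)\<^sup>2) \<longlonglongrightarrow> 0" by simp
    qed
    show "AE x in M. norm ((f x - s n x)\<^sup>2) \<le> 9 * (f x)\<^sup>2" for n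
    proof (rule AE_I2)
      fix x
      have "\<bar>f x - s n x\<bar> \<le> \<bar>3 * f x\<bar>" using bound[of n x] by linarith
      then have "(f x - s n x)\<^sup>2 \<le> (3 * f x)\<^sup>2" by (simp add: abs_le_square_iff)
      then show "norm ((f x - s n x)\<^sup>2) \<le> 9 * (f x)\<^sup>2" by (simp add: power_mult_distrib)
    qed
  qed simp_all
  then have *: "(\<lambda>n. sqrt (\<integral>x. (f x - s n x)\<^sup>2 \<partial>M)) \<longlonglongrightarrow> 0"
    using tendsto_real_sqrt by fastforce
  fix e :: real assume "e > 0"
  then obtain n where "sqrt (\<integral>x. (f x - s n x)\<^sup>2 \<partial>M) < e"
    using order_tendstoD(2)[OF *] by (auto simp: eventually_sequentially)
  then show "\<exists>h. lipschitz_approximable M h \<and> sqrt (\<integral>x. (f x - h x)\<^sup>2 \<partial>M) < e"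
    using s by blast
qed

lemma lipschitz_approximable_lipschitz:
  assumes "L-lipschitz_on UNIV f" "bounded (range f)"
  shows "lipschitz_approximable M f"
proof -
  obtain B where B: "\<And>x. \<bar>f x\<bar> \<le> B"
    using assms(2) by (auto simp: bounded_iff)
  have "f \<in> borel_measurable M"
    using borel_measurable_continuous_onI[OF lipschitz_on_continuous_on[OF assms(1)]]
    by (simp cong: measurable_cong_sets add: sets_M)
  then have "f \<in> L2 M" using B by (rule L2_bounded)
  then show ?thesis
    using assms by (auto simp: lipschitz_approximable_def intro!: exI[of _ f] exI[of _ L])
qed

lemma lipschitz_approximable_closed:
  fixes C :: "'a set"
  assumes "closed C"
  shows "lipschitz_approximable M (indicator C)"
proof (cases "C = {}")
  \<comment> \<open>Taken apart because \<open>infdist\<close> to the empty set is 0, which would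
    make every tent function below constantly 1.\<close>
  case True
  then show ?thesis
    using lipschitz_approximable_lipschitz[OF lipschitz_on_constant, of 0]
    by (simp add: indicator_def[abs_def])
next
  case False
  \<comment> \<open>Tent functions of slope \<open>n\<close>: equal to 1 on \<open>C\<close>, and
    eventually 0 at any point at positive distance from \<open>C\<close>.\<close>
  define g where "g n x = max 0 (1 - real n * infdist x C)" for n x
  have [measurable]: "C \<in> sets M" using \<open>closed C\<close> by (simp add: sets_M)
  have g: "lipschitz_approximable M (g n)" for n
  proof (rule lipschitz_approximable_lipschitz)
    show "(real n)-lipschitz_on UNIV (g n)"
    proof (rule lipschitz_onI)
      fix x y
      have "\<bar>real n * infdist x C - real n * infdist y C\<bar> \<le> real n * dist x y"
        using mult_left_mono[OF infdist_triangle_abs[of x C y], of "real n"]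
        by (simp add: abs_mult flip: right_diff_distrib)
      then show "dist (g n x) (g n y) \<le> real n * dist x y"
        by (auto simp: g_def dist_real_def)
    qed simp
    show "bounded (range (g n))"
      by (rule boundedI[where B=1]) (auto simp: g_def infdist_nonneg)
  qed
  have lim: "(\<lambda>n. g n x) \<longlonglongrightarrow> indicator C x" for x
  proof (cases "x \<in> C")
    case True
    then show ?thesis by (simp add: g_def)
  next
    case x: False
    then have "infdist x C > 0"
      using in_closed_iff_infdist_zero[OF \<open>closed C\<close> False] infdist_nonneg[of x C] by (auto simp: less_le)
    then obtain N where N: "real N * infdist x C > 1"
      using reals_Archimedean3 by blast
    have "g n x = 0" if "n \<ge> N" for n
    proof -
      have "real n * infdist x C \<ge> real N * infdist x C"
        using that \<open>infdist x C > 0\<close> by (intro mult_right_mono) auto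
      with N show ?thesis by (simp add: g_def)
    qed
    then have "eventually (\<lambda>n. g n x = 0) sequentially"
      by (auto simp: eventually_sequentially)
    then show ?thesis using x by (simp add: tendsto_eventually)
  qed
  show ?thesis
  proof (rule lipschitz_approximable_lim)
    show ind: "indicator C \<in> L2 M"
      by (rule L2_bounded[where B=1]) (auto split: split_indicator)
    have [measurable]: "g n \<in> borel_measurable M" for n
      using g[of n] by (auto simp: lipschitz_approximable_def L2_def)
    have "(\<lambda>n. \<integral>x. (indicator C x - g n x)\<^sup>2 \<partial>M) \<longlonglongrightarrow> (\<integral>x. 0 \<partial>M)"
    proof (rule integral_dominated_convergence[where w="\<lambda>x. 1"])
      show "AE x in M. (\<lambda>n. (indicator C x - g n x)\<^sup>2) \<longlonglongrightarrow> 0"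
      proof (rule AE_I2)
        fix x
        have "(\<lambda>n. (indicator C x - g n x)\<^sup>2) \<longlonglongrightarrow> (indicator C x - indicator C x)\<^sup>2"
          by (intro tendsto_intros lim)
        then show "(\<lambda>n. (indicator C x - g n x)\<^sup>2) \<longlonglongrightarrow> 0" by simp
      qed
      show "AE x in M. norm ((indicator C x - g n x)\<^sup>2) \<le> 1" for n
      proof (rule AE_I2)
        fix x
        have "g n x \<ge> 0" "g n x \<le> 1" by (auto simp: g_def infdist_nonneg)
        then have "\<bar>indicator C x - g n x\<bar> \<le> 1" by (auto split: split_indicator)
        then show "norm ((indicator C x - g n x)\<^sup>2) \<le> 1" by (simp add: abs_square_le_1)
      qed
    qed simp_all
    then have *: "(\<lambda>n. sqrt (\<integral>x. (indicator C x - g n x)\<^sup>2 \<partial>M)) \<longlonglongrightarrow> 0"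
      using tendsto_real_sqrt by fastforce
    fix e :: real assume "e > 0"
    then obtain n where "sqrt (\<integral>x. (indicator C x - g n x)\<^sup>2 \<partial>M) < e"
      using order_tendstoD(2)[OF *] by (auto simp: eventually_sequentially)
    then show "\<exists>h. lipschitz_approximable M h \<and> sqrt (\<integral>x. (indicator C x - h x)\<^sup>2 \<partial>M) < e"
      using g by blast
  qed
qed

lemma lipschitz_approximable_indicator:
  assumes B: "B \<in> sets borel"
  shows "lipschitz_approximable M (indicator B)"
proof (rule lipschitz_approximable_lim)
  show "indicator B \<in> L2 M"
    using B by (intro L2_bounded[where B=1]) (auto split: split_indicator simp: sets_M)
  fix e :: real assume "e > 0"
  then have "0 < e\<^sup>2" by simp
  \<comment> \<open>Inner regularity by compact sets. The tolerance is \<open>e\<^sup>2\<close>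
    since the squared distance of the two indicators is the measure of \<open>B - K\<close>. A null
    set is treated apart, as the strict inequality between \<open>ennreal\<close> values requires
    \<open>measure M B > 0\<close>.\<close>
  have "\<exists>K. K \<subseteq> B \<and> compact K \<and> measure M B - e\<^sup>2 < measure M K"
  proof (cases "measure M B = 0")
    case True
    then show ?thesis using \<open>0 < e\<^sup>2\<close> by (intro exI[of _ "{}"]) simp
  next
    case False
    have "ennreal (measure M B - e\<^sup>2) < ennreal (measure M B)"
      using False \<open>0 < e\<^sup>2\<close> by (intro ennreal_lessI) (auto simp: less_le)
    also have "ennreal (measure M B) = (SUP K \<in> {K. K \<subseteq> B \<and> compact K}. emeasure M K)"
      unfolding emeasure_eq_measure[symmetric] by (rule inner_regular[OF sets_M _ B]) simp
    finally obtain K where "K \<subseteq> B" "compact K" "ennreal (measure M B - e\<^sup>2) < emeasure M K"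
      unfolding less_SUP_iff by (elim bexE CollectE conjE)
    moreover have "measure M B - e\<^sup>2 < measure M K"
    proof (rule ccontr)
      assume "\<not> ?thesis"
      then have "emeasure M K \<le> ennreal (measure M B - e\<^sup>2)"
        unfolding emeasure_eq_measure by (intro ennreal_leI) linarith
      then show False using \<open>ennreal (measure M B - e\<^sup>2) < emeasure M K\<close> by simp
    qed
    ultimately show ?thesis by blast
  qed
  then obtain K where K: "K \<subseteq> B" "compact K" "measure M B - e\<^sup>2 < measure M K" by blast
  have "(\<lambda>x. (indicator B x - indicator K x)\<^sup>2) = (indicator (B - K) :: 'a \<Rightarrow> real)"
    using K(1) by (auto simp: fun_eq_iff split: split_indicator)
  then have "(\<integral>x. (indicator B x - indicator K x)\<^sup>2 \<partial>M) = measure M (B - K)"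
    by simp
  also have "\<dots> = measure M B - measure M K"
    using K B by (intro finite_measure_Diff) (auto simp: sets_M compact_imp_closed)
  finally have "(\<integral>x. (indicator B x - indicator K x)\<^sup>2 \<partial>M) < e\<^sup>2" using K(3) by simp
  then have "sqrt (\<integral>x. (indicator B x - indicator K x)\<^sup>2 \<partial>M) < e"
    using \<open>e > 0\<close> by (intro real_less_lsqrt) auto
  then show "\<exists>h. lipschitz_approximable M h \<and> sqrt (\<integral>x. (indicator B x - h x)\<^sup>2 \<partial>M) < e"
    using lipschitz_approximable_closed[OF compact_imp_closed[OF K(2)]] by blast
qed

text \<open>Standard bootstrapping: closed sets, then Borel sets, then simple functions by
  linearity, then all of \<open>L2 M\<close> by dominated convergence.\<close>

theorem L2_lipschitz_approximable:
  assumes f: "f \<in> L2 M"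
  shows "lipschitz_approximable M f"
proof -
  have "f \<in> borel_measurable M" using f by (simp add: L2_def)
  from borel_measurable_implies_sequence_metric[OF this, of 0]
  obtain s where s: "\<And>n. simple_function M (s n)" "\<And>x. (\<lambda>n. s n x) \<longlonglongrightarrow> f x"
    "\<And>n x. \<bar>s n x\<bar> \<le> 2 * \<bar>f x\<bar>"
    by auto
  show ?thesis
  proof (rule lipschitz_approximable_lim_dominated[OF f _ s(2,3)])
    fix n
    have fin: "finite (range (s n))"
      using simple_functionD(1)[OF s(1)[of n]] by simp
    \<comment> \<open>Stated for an arbitrary finite \<open>Y\<close> so that induction applies; the
      range of \<open>s n\<close> is then inserted.\<close>
    have "lipschitz_approximable M (\<lambda>x. \<Sum>y\<in>Y. y * indicator (s n -` {y}) x)" if "finite Y" for Y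
      using that
    proof (induction Y)
      case empty
      then show ?case
        using lipschitz_approximable_lipschitz[of 0 "\<lambda>_. 0"] by (simp add: lipschitz_on_constant)
    next
      case (insert y Y)
      have "s n -` {y} \<in> sets borel"
        using simple_functionD(2)[OF s(1)[of n], of "{y}"] by (simp add: sets_M)
      then show ?case
        unfolding sum.insert[OF insert.hyps]
        by (intro lipschitz_approximable_add lipschitz_approximable_scale
              lipschitz_approximable_indicator insert.IH)
    qed
    from this[OF fin]
    have "lipschitz_approximable M (\<lambda>x. \<Sum>y\<in>range (s n). y * indicator (s n -` {y}) x)" .
    moreover have "(\<Sum>y\<in>range (s n). y * indicator (s n -` {y}) x) = s n x" for x
    proof -
      have "(\<Sum>y\<in>range (s n). y * indicator (s n -` {y}) x)
          = (\<Sum>y\<in>range (s n). if y = s n x then s n x else 0)"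
        by (rule sum.cong) (auto split: split_indicator)
      then show ?thesis using fin by simp
    qed
    ultimately show "lipschitz_approximable M (s n)" by simp
  qed
qed

end

subsection \<open>Contraction and self-adjointness of the averaging operator\<close>

text \<open>An inequality in place of an equality, so that integrability never has to be checked: a
  non-integrable \<open>f\<close> has Bochner integral 0.\<close>

lemma ennreal_integral_le_nn_integral:
  fixes f :: "'a \<Rightarrow> real"
  assumes "\<And>x. 0 \<le> f x"
  shows "ennreal (\<integral>x. f x \<partial>M) \<le> (\<integral>\<^sup>+x. ennreal (f x) \<partial>M)"
  using assms by (cases "integrable M f") (auto simp: nn_integral_eq_integral not_integrable_integral_eq)

lemma lipschitz_on_UNIV_borel_measurable:
  fixes f :: "'a::metric_space \<Rightarrow> real"
  shows "L-lipschitz_on UNIV f \<Longrightarrow> f \<in> borel_measurable borel"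
  by (intro borel_measurable_continuous_onI lipschitz_on_continuous_on)

text \<open>The easy half of Kantorovich duality.\<close>

lemma transport_dist_lipschitz:
  fixes \<mu> \<nu> :: "'a::polish_space measure"
  assumes "prob_space \<mu>"
    and T: "transport_dist \<mu> \<nu> \<le> ennreal t" and "0 \<le> t"
    and L: "L-lipschitz_on UNIV f" and bound: "\<And>x. \<bar>f x\<bar> \<le> B"
  shows "\<bar>(\<integral>x. f x \<partial>\<mu>) - (\<integral>x. f x \<partial>\<nu>)\<bar> \<le> L * t"
proof -
  have L0: "0 \<le> L" using L by (rule lipschitz_on_nonneg)
  have [measurable]: "f \<in> borel_measurable borel"
    using L by (rule lipschitz_on_UNIV_borel_measurable)
  \<comment> \<open>The infimum over couplings may not be attained, so the estimate is made for
    every \<open>b\<close> above \<open>t\<close>, where some coupling costs less than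
    \<open>b\<close>.\<close>
  have main: "\<bar>(\<integral>x. f x \<partial>\<mu>) - (\<integral>x. f x \<partial>\<nu>)\<bar> \<le> L * b" if "t < b" for b
  proof -
    have "transport_dist \<mu> \<nu> < ennreal b"
      using T that \<open>0 \<le> t\<close> by (intro le_less_trans[OF T] ennreal_lessI) auto
    then obtain \<xi> where \<xi>: "sets \<xi> = sets borel" "distr \<xi> borel fst = \<mu>" "distr \<xi> borel snd = \<nu>"
      and cost: "(\<integral>\<^sup>+z. ennreal (dist (fst z) (snd z)) \<partial>\<xi>) < ennreal b"
      unfolding transport_dist_def INF_less_iff couplings_def by auto
    note [measurable_cong] = \<xi>(1)
    have [measurable]: "fst \<in> \<xi> \<rightarrow>\<^sub>M borel" "snd \<in> \<xi> \<rightarrow>\<^sub>M borel"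
      unfolding measurable_cong_sets[OF \<xi>(1) refl] borel_prod[symmetric] by measurable
    interpret \<xi>: prob_space \<xi>
      by (rule prob_space_distrD[of fst _ borel]) (simp_all add: \<xi>(2) assms(1))
    have int: "integrable \<xi> (\<lambda>z. f (fst z))" "integrable \<xi> (\<lambda>z. f (snd z))"
      by (rule \<xi>.integrable_const_bound[where B=B]; use bound in simp)+
    have "(\<integral>x. f x \<partial>\<mu>) - (\<integral>x. f x \<partial>\<nu>) = (\<integral>z. f (fst z) - f (snd z) \<partial>\<xi>)"
      unfolding \<xi>(2,3)[symmetric] using int by (simp add: integral_distr)
    then have "ennreal \<bar>(\<integral>x. f x \<partial>\<mu>) - (\<integral>x. f x \<partial>\<nu>)\<bar> \<le> ennreal (\<integral>z. \<bar>f (fst z) - f (snd z)\<bar> \<partial>\<xi>)"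
      by (simp add: integral_abs_bound ennreal_leI)
    also have "\<dots> \<le> (\<integral>\<^sup>+z. ennreal \<bar>f (fst z) - f (snd z)\<bar> \<partial>\<xi>)"
      by (rule ennreal_integral_le_nn_integral) simp
    also have "\<dots> \<le> (\<integral>\<^sup>+z. ennreal L * ennreal (dist (fst z) (snd z)) \<partial>\<xi>)"
      using lipschitz_onD[OF L] L0
      by (intro nn_integral_mono) (auto simp: dist_real_def ennreal_leI simp flip: ennreal_mult)
    also have "\<dots> = ennreal L * (\<integral>\<^sup>+z. ennreal (dist (fst z) (snd z)) \<partial>\<xi>)"
      by (rule nn_integral_cmult) measurable
    also have "\<dots> \<le> ennreal L * ennreal b"
      using cost by (intro mult_left_mono) auto
    also have "\<dots> = ennreal (L * b)"
      using L0 by (simp add: ennreal_mult')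
    finally show ?thesis
      using L0 that \<open>0 \<le> t\<close> by (subst (asm) ennreal_le_iff) auto
  qed
  show ?thesis
  proof (rule field_le_epsilon)
    fix e :: real assume "e > 0"
    \<comment> \<open>The excess is \<open>e / (L + 1)\<close> and not \<open>e / L\<close> because
      \<open>L\<close> may be 0.\<close>
    have "\<bar>(\<integral>x. f x \<partial>\<mu>) - (\<integral>x. f x \<partial>\<nu>)\<bar> \<le> L * (t + e / (L + 1))"
      using L0 \<open>e > 0\<close> by (intro main) auto
    also have "\<dots> \<le> L * t + e"
      using L0 \<open>e > 0\<close> by (simp add: field_simps)
    finally show "\<bar>(\<integral>x. f x \<partial>\<mu>) - (\<integral>x. f x \<partial>\<nu>)\<bar> \<le> L * t + e" .
  qed
qed

text \<open>By log-convexity the ratios \<open>a (Suc n) / a n\<close> increase, so their limit, bounded by the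
  geometric decay rate, bounds the first ratio.\<close>

lemma log_convex_ratio_le:
  fixes a :: "nat \<Rightarrow> real"
  assumes nonneg: "\<And>n. 0 \<le> a n" and q: "0 \<le> q" "q < 1"
    and decay: "\<And>n. a n - a (Suc n) \<le> C * q ^ n" and lim: "a \<longlonglongrightarrow> 0"
    and log_convex: "\<And>n. (a (Suc n))\<^sup>2 \<le> a n * a (Suc (Suc n))"
  shows "a 1 \<le> q * a 0"
proof (rule ccontr)
  assume less: "\<not> a 1 \<le> q * a 0"
  \<comment> \<open>The sum of the geometric series bounding the decrements: telescoping from
    \<open>n\<close> to infinity, where \<open>a\<close> vanishes, gives
    \<open>a n \<le> D * q ^ n\<close>.\<close>
  define D where "D = C / (1 - q)"
  have geom: "a n \<le> D * q ^ n" for n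
  proof -
    have "a n - a (n + k) \<le> D * (q ^ n - q ^ (n + k))" for k
    proof (induction k)
      case (Suc k)
      have "D * (q ^ (n + k) - q ^ (n + Suc k)) = C * q ^ (n + k)"
        using q by (simp add: D_def field_simps)
      then show ?case using Suc decay[of "n + k"] by (simp add: algebra_simps)
    qed simp
    moreover have "(\<lambda>k. a n - a (n + k)) \<longlonglongrightarrow> a n - 0"
      using LIMSEQ_ignore_initial_segment[OF lim, of n]
      by (intro tendsto_intros) (simp add: add.commute)
    moreover have "(\<lambda>k. D * (q ^ n - q ^ (n + k))) \<longlonglongrightarrow> D * (q ^ n - 0)"
      using LIMSEQ_ignore_initial_segment[OF LIMSEQ_power_zero[of q], of n] q
      by (intro tendsto_intros) (simp add: add.commute)
    ultimately show ?thesis using LIMSEQ_le by fastforce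
  qed
  have "0 \<le> q * a 0" using q nonneg by simp
  with less have a1: "a 1 > 0" by simp
  \<comment> \<open>Log-convexity at 0 excludes \<open>a 0 = 0\<close>, so the first ratio
    \<open>r\<close> is meaningful; by assumption it exceeds \<open>q\<close>.\<close>
  then have "(a 1)\<^sup>2 > 0" by simp
  with log_convex[of 0] have "a 0 \<noteq> 0" by auto
  then have a0: "a 0 > 0" using nonneg[of 0] by simp
  define r where "r = a 1 / a 0"
  have r: "r > q" "r > 0" using less a0 a1 by (auto simp: r_def field_simps)
  \<comment> \<open>Positivity is carried along in the induction because \<open>log_convex\<close>
    has to be divided by \<open>a n\<close>.\<close>
  have step: "a n > 0 \<and> r * a n \<le> a (Suc n)" for n
  proof (induction n)
    case 0
    then show ?case using a0 by (simp add: r_def)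
  next
    case (Suc n)
    then have IH: "a n > 0" "r * a n \<le> a (Suc n)" by simp_all
    have "0 < r * a n" using IH(1) r(2) by simp
    with IH(2) have pos: "a (Suc n) > 0" by linarith
    have "a n * (r * a (Suc n)) = (r * a n) * a (Suc n)" by simp
    also have "\<dots> \<le> a (Suc n) * a (Suc n)"
      using IH(2) pos by (intro mult_right_mono) simp_all
    also have "\<dots> \<le> a n * a (Suc (Suc n))"
      using log_convex[of n] by (simp add: power2_eq_square)
    finally have "r * a (Suc n) \<le> a (Suc (Suc n))"
      using IH(1) by (rule mult_left_le_imp_le)
    with pos show ?case by simp
  qed
  have lower: "r ^ n * a 0 \<le> a n" for n
  proof (induction n)
    case (Suc n)
    have "r ^ Suc n * a 0 \<le> r * a n"
      using mult_left_mono[OF Suc, of r] r by (simp add: mult_ac)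
    then show ?case using step[of n] by simp
  qed simp
  \<comment> \<open>Growth at least \<open>r ^ n\<close> against decay \<open>q ^ n\<close> with
    \<open>q < r\<close>; letting \<open>n\<close> tend to infinity forces
    \<open>a 0 \<le> 0\<close>.\<close>
  have "a 0 \<le> D * (q / r) ^ n" for n
    using order_trans[OF lower[of n] geom[of n]] r by (simp add: field_simps)
  moreover have "(\<lambda>n. D * (q / r) ^ n) \<longlonglongrightarrow> D * 0"
    using q r by (intro tendsto_intros LIMSEQ_power_zero) auto
  ultimately have "a 0 \<le> 0"
    using LIMSEQ_le_const by fastforce
  with a0 show False by simp
qed

section \<open>Lipschitz and variance estimates under a curvature bound\<close>

locale curved_walk = invariant_kernel m \<nu>
  for m :: "'a::polish_space \<Rightarrow> 'a measure" and \<nu> +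
  fixes c S :: real
  \<comment> \<open>\<open>c = 1 - \<kappa>\<close>, and \<open>S\<close> bounds \<open>\<sigma>\<^sup>2\<close>.\<close>
  assumes c: "0 \<le> c" "c < 1"
    and contract: "\<And>x y. transport_dist (m x) (m y) \<le> ennreal (c * dist x y)"
    and spread: "(\<integral>\<^sup>+x. (spread_at m x)\<^sup>2 \<partial>\<nu>) \<le> ennreal S"
    and S_nonneg: "0 \<le> S"
    and reversible: "\<nu> \<bind> (\<lambda>x. m x \<bind> (\<lambda>y. return borel (x, y))) =
      \<nu> \<bind> (\<lambda>y. m y \<bind> (\<lambda>x. return borel (x, y)))"
begin

lemma averaging_bounded:
  assumes "f \<in> borel_measurable borel" "\<And>x. \<bar>f x\<bar> \<le> B"
  shows "\<bar>averaging m f x\<bar> \<le> B"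
proof -
  have "\<bar>averaging m f x\<bar> \<le> (\<integral>y. \<bar>f y\<bar> \<partial>m x)"
    unfolding averaging_def by (rule integral_abs_bound)
  also have "\<dots> \<le> (\<integral>y. B \<partial>m x)"
    using assms by (intro integral_mono K.integrable_const_bound[where f="\<lambda>y. \<bar>f y\<bar>" and B=B] K.integrable_const) simp_all
  finally show ?thesis by (simp add: K.prob_space)
qed

lemma averaging_lipschitz:
  assumes L: "L-lipschitz_on UNIV f" and bound: "\<And>x. \<bar>f x\<bar> \<le> B"
  shows "(c * L)-lipschitz_on UNIV (averaging m f)"
proof (rule lipschitz_onI)
  fix x y
  have "\<bar>averaging m f x - averaging m f y\<bar> \<le> L * (c * dist x y)"
    unfolding averaging_def
    by (rule transport_dist_lipschitz[OF prob_space_kernel contract _ L bound]) (simp add: c)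
  then show "dist (averaging m f x) (averaging m f y) \<le> c * L * dist x y"
    by (simp add: dist_real_def mult_ac)
qed (use c lipschitz_on_nonneg[OF L] in simp)

lemma ennreal_root2_square: "(ennreal_root2 t)\<^sup>2 = t"
proof (cases t)
  case (real r)
  then show ?thesis by (simp add: ennreal_root2_def ennreal_power)
qed (simp add: ennreal_root2_def)

text \<open>Write the variance as half the double integral of \<open>(f y - f z)^2\<close> and bound
  the integrand by \<open>L^2 d(y,z)^2\<close>. The inequality lives in \<open>ennreal\<close>
  because the spread at a single point may be infinite.\<close>

lemma Var_kernel_lipschitz:
  assumes L: "L-lipschitz_on UNIV f" and bound: "\<And>x. \<bar>f x\<bar> \<le> B"
  shows "ennreal (Var (m x) f) \<le> ennreal (L\<^sup>2) * (spread_at m x)\<^sup>2"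
proof -
  have [measurable]: "f \<in> borel_measurable borel"
    using L by (rule lipschitz_on_UNIV_borel_measurable)
  have f: "f \<in> L2 (m x)" using bound by (intro K.L2_bounded) auto
  have "ennreal (2 * Var (m x) f) = ennreal (\<integral>z. (\<integral>y. (f y - f z)\<^sup>2 \<partial>m x) \<partial>m x)"
    by (simp add: K.Var_double_integral[OF f])
  also have "\<dots> \<le> (\<integral>\<^sup>+z. ennreal (\<integral>y. (f y - f z)\<^sup>2 \<partial>m x) \<partial>m x)"
    by (rule ennreal_integral_le_nn_integral) simp
  also have "\<dots> \<le> (\<integral>\<^sup>+z. \<integral>\<^sup>+y. ennreal ((f y - f z)\<^sup>2) \<partial>m x \<partial>m x)"
    by (intro nn_integral_mono ennreal_integral_le_nn_integral) simp
  also have "\<dots> \<le> (\<integral>\<^sup>+z. \<integral>\<^sup>+y. ennreal (L\<^sup>2) * ennreal ((dist y z)\<^sup>2) \<partial>m x \<partial>m x)"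
  proof (intro nn_integral_mono)
    fix y z
    have "\<bar>f y - f z\<bar> \<le> L * dist y z"
      using lipschitz_onD[OF L] by (simp add: dist_real_def)
    then have "(f y - f z)\<^sup>2 \<le> (L * dist y z)\<^sup>2"
      using power_mono[of "\<bar>f y - f z\<bar>" "L * dist y z" 2] by simp
    then show "ennreal ((f y - f z)\<^sup>2) \<le> ennreal (L\<^sup>2) * ennreal ((dist y z)\<^sup>2)"
      by (simp add: power_mult_distrib ennreal_leI flip: ennreal_mult)
  qed
  also have "\<dots> = ennreal (L\<^sup>2) * (\<integral>\<^sup>+z. \<integral>\<^sup>+y. ennreal ((dist y z)\<^sup>2) \<partial>m x \<partial>m x)"
    by (simp add: nn_integral_cmult)
  finally have "ennreal (1/2) * ennreal (2 * Var (m x) f)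
      \<le> ennreal (1/2) * (ennreal (L\<^sup>2) * (\<integral>\<^sup>+z. \<integral>\<^sup>+y. ennreal ((dist y z)\<^sup>2) \<partial>m x \<partial>m x))"
    by (rule mult_left_mono) simp
  moreover have "ennreal (1/2) * ennreal (2 * Var (m x) f) = ennreal (Var (m x) f)"
    by (subst ennreal_mult[symmetric]) (simp_all add: Var_nonneg)
  ultimately show ?thesis
    unfolding spread_at_def ennreal_root2_square by (simp only: mult_ac)
qed

lemma integral_Var_kernel_lipschitz:
  assumes L: "L-lipschitz_on UNIV f" and bound: "\<And>x. \<bar>f x\<bar> \<le> B"
  shows "(\<integral>x. Var (m x) f \<partial>\<nu>) \<le> L\<^sup>2 * S"
proof -
  have "ennreal (\<integral>x. Var (m x) f \<partial>\<nu>) \<le> (\<integral>\<^sup>+x. ennreal (Var (m x) f) \<partial>\<nu>)"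
    by (rule ennreal_integral_le_nn_integral) (rule Var_nonneg)
  also have "\<dots> \<le> (\<integral>\<^sup>+x. ennreal (L\<^sup>2) * (spread_at m x)\<^sup>2 \<partial>\<nu>)"
    by (intro nn_integral_mono Var_kernel_lipschitz[OF L bound])
  also have "\<dots> = ennreal (L\<^sup>2) * (\<integral>\<^sup>+x. (spread_at m x)\<^sup>2 \<partial>\<nu>)"
  proof (rule nn_integral_cmult)
    \<comment> \<open>The measure \<open>m x\<close> occurs twice in the spread, so the inner
      integral must be measurable jointly in \<open>x\<close> and \<open>z\<close>; the kernel is
      pulled back along the first projection.\<close>
    have inner: "(\<lambda>(x, z). \<integral>\<^sup>+y. ennreal ((dist y z)\<^sup>2) \<partial>m x) \<in> borel_measurable (\<nu> \<Otimes>\<^sub>M borel)"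
      unfolding case_prod_beta
    proof (rule nn_integral_measurable_subprob_algebra2)
      show "(\<lambda>p. m (fst p)) \<in> \<nu> \<Otimes>\<^sub>M borel \<rightarrow>\<^sub>M subprob_algebra borel"
        using measurable_compose[OF measurable_fst kernel_subprob] .
    qed measurable
    show "(\<lambda>x. (spread_at m x)\<^sup>2) \<in> borel_measurable \<nu>"
      unfolding spread_at_def ennreal_root2_square
      using nn_integral_measurable_subprob_algebra2[OF inner kernel_subprob] by measurable
  qed
  also have "\<dots> \<le> ennreal (L\<^sup>2) * ennreal S"
    by (intro mult_left_mono spread) simp
  finally show ?thesis
    using S_nonneg by (simp flip: ennreal_mult)
qed

section \<open>Self-adjointness from reversibility\<close>

text \<open>The map \<open>p\<close> is a parameter so that both sides of \<open>reversible\<close>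
  are instances: the pair in order and the pair swapped. Each inner bind with \<open>return\<close>
  is a pushforward of \<open>m x\<close>.\<close>

lemma nn_integral_joint:
  fixes F :: "'a \<times> 'a \<Rightarrow> ennreal" and p :: "'a \<Rightarrow> 'a \<Rightarrow> 'a \<times> 'a"
  assumes F: "F \<in> borel_measurable borel" and p: "case_prod p \<in> borel \<rightarrow>\<^sub>M borel"
  shows "(\<integral>\<^sup>+z. F z \<partial>(\<nu> \<bind> (\<lambda>x. m x \<bind> (\<lambda>y. return borel (p x y))))) =
    (\<integral>\<^sup>+x. \<integral>\<^sup>+y. F (p x y) \<partial>m x \<partial>\<nu>)"
proof -
  have p': "case_prod p \<in> \<nu> \<Otimes>\<^sub>M borel \<rightarrow>\<^sub>M borel"
    using p by (simp add: borel_prod[symmetric] cong: measurable_cong_sets)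
  have px: "p x \<in> m x \<rightarrow>\<^sub>M borel" for x
    using measurable_compose_Pair1[of x \<nu>, OF _ p'] by (simp cong: measurable_cong_sets)
  have bind: "m x \<bind> (\<lambda>y. return borel (p x y)) = distr (m x) borel (p x)" for x
    by (rule bind_return_distr'[OF _ px]) (rule K.not_empty)
  have "(\<lambda>x. distr (m x) borel (p x)) \<in> \<nu> \<rightarrow>\<^sub>M subprob_algebra borel"
    by (rule measurable_distr2[OF p' kernel_subprob])
  from nn_integral_bind[OF F this] show ?thesis
    using px F by (simp add: bind nn_integral_distr)
qed

text \<open>For nonnegative functions both pairings are iterated nonnegative integrals of
  \<open>f(x) g(y)\<close>, one for each order of the joint law, and reversibility identifies the
  two orders.\<close>

lemma averaging_self_adjoint_nonneg:
  assumes [measurable]: "f \<in> borel_measurable borel" "g \<in> borel_measurable borel"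
    and f: "\<And>x. 0 \<le> f x" "\<And>x. \<bar>f x\<bar> \<le> B" and g: "\<And>x. 0 \<le> g x" "\<And>x. \<bar>g x\<bar> \<le> B"
  shows "(\<integral>x. f x * averaging m g x \<partial>\<nu>) = (\<integral>x. g x * averaging m f x \<partial>\<nu>)"
proof -
  have half: "ennreal (\<integral>x. f x * averaging m g x \<partial>\<nu>) = (\<integral>\<^sup>+x. \<integral>\<^sup>+y. ennreal (f x * g y) \<partial>m x \<partial>\<nu>)"
    if [measurable]: "f \<in> borel_measurable borel" "g \<in> borel_measurable borel"
    and f: "\<And>x. 0 \<le> f x" "\<And>x. \<bar>f x\<bar> \<le> B" and g: "\<And>x. 0 \<le> g x" "\<And>x. \<bar>g x\<bar> \<le> B" for f g
  proof -
    have int: "integrable \<nu> (\<lambda>x. f x * averaging m g x)"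
      using f g by (intro L2_mult_integrable averaging_L2 L2_bounded[where B=B]) simp_all
    have nonneg: "0 \<le> averaging m g x" for x
      by (simp add: averaging_def g)
    have "ennreal (\<integral>x. f x * averaging m g x \<partial>\<nu>) = (\<integral>\<^sup>+x. ennreal (f x * averaging m g x) \<partial>\<nu>)"
      using nn_integral_eq_integral[OF int] f nonneg by simp
    also have "\<dots> = (\<integral>\<^sup>+x. \<integral>\<^sup>+y. ennreal (f x * g y) \<partial>m x \<partial>\<nu>)"
    proof (rule nn_integral_cong)
      fix x
      have "integrable (m x) (\<lambda>y. f x * g y)"
        using g by (intro integrable_mult_right K.integrable_const_bound[where B=B]) simp_all
      from nn_integral_eq_integral[OF this]
      show "ennreal (f x * averaging m g x) = (\<integral>\<^sup>+y. ennreal (f x * g y) \<partial>m x)"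
        using f g by (simp add: averaging_def)
    qed
    finally show ?thesis .
  qed
  define F where "F z = ennreal (f (fst z) * g (snd z))" for z
  have F: "F \<in> borel_measurable borel"
    unfolding F_def borel_prod[symmetric] by measurable
  have "(\<integral>\<^sup>+x. \<integral>\<^sup>+y. F (x, y) \<partial>m x \<partial>\<nu>) = (\<integral>\<^sup>+y. \<integral>\<^sup>+x. F (x, y) \<partial>m y \<partial>\<nu>)"
    using nn_integral_joint[OF F, of "\<lambda>x y. (x, y)"] nn_integral_joint[OF F, of "\<lambda>y x. (x, y)"]
      reversible by (simp add: borel_prod[symmetric])
  then have "ennreal (\<integral>x. f x * averaging m g x \<partial>\<nu>) = ennreal (\<integral>x. g x * averaging m f x \<partial>\<nu>)"
    using half[of f g] half[of g f] f g by (simp add: F_def mult.commute)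
  then show ?thesis
    using f g by (subst (asm) ennreal_inj) (simp_all add: averaging_def)
qed

text \<open>Adding the bound \<open>B\<close> makes both functions nonnegative. The correction terms
  in \<open>shift\<close> are symmetric in \<open>f\<close> and \<open>g\<close>, so they
  cancel.\<close>

lemma averaging_self_adjoint:
  assumes [measurable]: "f \<in> borel_measurable borel" "g \<in> borel_measurable borel"
    and f: "\<And>x. \<bar>f x\<bar> \<le> B" and g: "\<And>x. \<bar>g x\<bar> \<le> B"
  shows "(\<integral>x. f x * averaging m g x \<partial>\<nu>) = (\<integral>x. g x * averaging m f x \<partial>\<nu>)"
proof -
  have shift: "(\<integral>x. (f x + B) * averaging m (\<lambda>x. g x + B) x \<partial>\<nu>)
      = (\<integral>x. f x * averaging m g x \<partial>\<nu>) + B * (\<integral>x. f x \<partial>\<nu>) + B * (\<integral>x. g x \<partial>\<nu>) + B * B"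
    if [measurable]: "f \<in> borel_measurable borel" "g \<in> borel_measurable borel"
    and f: "\<And>x. \<bar>f x\<bar> \<le> B" and g: "\<And>x. \<bar>g x\<bar> \<le> B" for f g
  proof -
    have fL: "f \<in> L2 \<nu>" and gL: "g \<in> L2 \<nu>"
      using f g by (auto intro!: L2_bounded[where B=B])
    have "integrable (m x) g" for x
      using g by (intro K.integrable_const_bound[where B=B]) simp_all
    then have "averaging m (\<lambda>x. g x + B) x = averaging m g x + B" for x
      by (simp add: averaging_def K.prob_space)
    then have "(\<integral>x. (f x + B) * averaging m (\<lambda>x. g x + B) x \<partial>\<nu>)
        = (\<integral>x. f x * averaging m g x + B * f x + B * averaging m g x + B * B \<partial>\<nu>)"
      by (simp add: algebra_simps)
    also have "\<dots> = (\<integral>x. f x * averaging m g x \<partial>\<nu>) + B * (\<integral>x. f x \<partial>\<nu>) + B * (\<integral>x. g x \<partial>\<nu>) + B * B"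
      using L2_mult_integrable[OF fL averaging_L2[OF gL]] L2_integrable[OF fL] L2_integrable[OF gL]
      by (simp add: integrable_averaging integral_averaging prob_UNIV)
    finally show ?thesis .
  qed
  have "(\<integral>x. (f x + B) * averaging m (\<lambda>x. g x + B) x \<partial>\<nu>)
      = (\<integral>x. (g x + B) * averaging m (\<lambda>x. f x + B) x \<partial>\<nu>)"
  proof (rule averaging_self_adjoint_nonneg[where B="2 * B"])
    fix x
    show "0 \<le> f x + B" "\<bar>f x + B\<bar> \<le> 2 * B" "0 \<le> g x + B" "\<bar>g x + B\<bar> \<le> 2 * B"
      using f[of x] g[of x] by linarith+
  qed simp_all
  then show ?thesis
    using shift[OF assms] shift[OF assms(2,1) g f] by simp
qed

end

section \<open>Contraction of the variance by the averaging operator\<close>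

context curved_walk
begin

lemma averaging_contracts_lipschitz:
  assumes L: "L-lipschitz_on UNIV f" and bound: "\<And>x. \<bar>f x\<bar> \<le> B"
  shows "Var \<nu> (averaging m f) \<le> c\<^sup>2 * Var \<nu> f"
proof -
  have f_meas [measurable]: "f \<in> borel_measurable borel"
    using L by (rule lipschitz_on_UNIV_borel_measurable)
  define b where "b = (\<integral>x. f x \<partial>\<nu>)"
  \<comment> \<open>Centering makes every iterate \<open>u n\<close> have mean 0, so variances
    become second moments and the inner products below need no correction.\<close>
  define h where "h x = f x + (- b)" for x
  define u where "u n = (averaging m ^^ n) h" for n
  define D where "D = B + \<bar>b\<bar>"
  have fL: "f \<in> L2 \<nu>" using bound by (intro L2_bounded) simp_all
  have u_Suc: "u (Suc n) = averaging m (u n)" for n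
    by (simp add: u_def)
  have lip_bound: "(c ^ n * L)-lipschitz_on UNIV (u n) \<and> (\<forall>x. \<bar>u n x\<bar> \<le> D)" for n
  proof (induction n)
    case 0
    have "(L + 0)-lipschitz_on UNIV h"
      unfolding h_def by (intro lipschitz_on_add L lipschitz_on_constant)
    moreover have "\<bar>h x\<bar> \<le> D" for x
      using bound[of x] by (simp add: h_def D_def)
    ultimately show ?case by (simp add: u_def)
  next
    case (Suc n)
    then have lip: "(c ^ n * L)-lipschitz_on UNIV (u n)" and bd: "\<And>x. \<bar>u n x\<bar> \<le> D" by auto
    show ?case
      using averaging_lipschitz[OF lip bd] averaging_bounded[OF lipschitz_on_UNIV_borel_measurable[OF lip] bd]
      by (simp add: u_Suc mult.assoc)
  qed
  then have lip: "(c ^ n * L)-lipschitz_on UNIV (u n)" and bd: "\<bar>u n x\<bar> \<le> D" for n x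
    by auto
  have meas [measurable]: "u n \<in> borel_measurable borel" for n
    using lip by (rule lipschitz_on_UNIV_borel_measurable)
  have uL: "u n \<in> L2 \<nu>" for n
    using bd by (intro L2_bounded) simp_all
  have mean: "(\<integral>x. u n x \<partial>\<nu>) = 0" for n
  proof (induction n)
    case 0
    show ?case using L2_integrable[OF fL] by (simp add: u_def h_def b_def prob_UNIV)
  next
    case (Suc n)
    then show ?case using integral_averaging[OF L2_integrable[OF uL[of n]]] by (simp add: u_Suc)
  qed
  define a where "a n = (\<integral>x. (u n x)\<^sup>2 \<partial>\<nu>)" for n
  have a_Var: "a n = Var \<nu> (u n)" for n
    unfolding a_def Var_def mean by simp
  have "a 1 \<le> c\<^sup>2 * a 0"
  proof (rule log_convex_ratio_le)
    show "0 \<le> a n" for n by (simp add: a_def)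
    show "0 \<le> c\<^sup>2" "c\<^sup>2 < 1" using c by (simp_all add: power_less_one_iff abs_square_less_1)
    \<comment> \<open>The decrement is the mean kernel variance of \<open>u n\<close>, whose
      Lipschitz constant is \<open>c ^ n * L\<close>.\<close>
    show "a n - a (Suc n) \<le> (L\<^sup>2 * S) * (c\<^sup>2) ^ n" for n
    proof -
      have "a n - a (Suc n) = (\<integral>x. Var (m x) (u n) \<partial>\<nu>)"
        unfolding a_Var u_Suc by (rule integral_Var_kernel[OF uL, symmetric])
      also have "\<dots> \<le> (c ^ n * L)\<^sup>2 * S"
        by (rule integral_Var_kernel_lipschitz[OF lip bd])
      finally show ?thesis by (simp add: power_mult_distrib mult_ac flip: power_mult)
    qed
    show "a \<longlonglongrightarrow> 0"
    proof -
      \<comment> \<open>The shrinking Lipschitz constants give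
        \<open>u n x - u n x0 \<longlonglongrightarrow> 0\<close> pointwise, with uniform bound
        \<open>2 * D\<close>. The variance is at most the second moment around the number
        \<open>u n x0\<close>, whatever the choice of \<open>x0\<close>.\<close>
      fix x0 :: 'a
      have "(\<lambda>n. \<integral>x. (u n x - u n x0)\<^sup>2 \<partial>\<nu>) \<longlonglongrightarrow> (\<integral>x. 0 \<partial>\<nu>)"
      proof (rule integral_dominated_convergence[where w="\<lambda>x. (2 * D)\<^sup>2"])
        show "AE x in \<nu>. (\<lambda>n. (u n x - u n x0)\<^sup>2) \<longlonglongrightarrow> 0"
        proof (rule AE_I2)
          fix x
          have "(\<lambda>n. u n x - u n x0) \<longlonglongrightarrow> 0"
          proof (rule Lim_null_comparison)
            show "\<forall>\<^sub>F n in sequentially. norm (u n x - u n x0) \<le> c ^ n * (L * dist x x0)"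
              using lipschitz_onD[OF lip] by (intro always_eventually) (simp add: dist_real_def mult.assoc)
            show "(\<lambda>n. c ^ n * (L * dist x x0)) \<longlonglongrightarrow> 0"
              using c by (intro tendsto_mult_left_zero LIMSEQ_power_zero) simp
          qed
          from tendsto_power[OF this, of 2] show "(\<lambda>n. (u n x - u n x0)\<^sup>2) \<longlonglongrightarrow> 0" by simp
        qed
        show "AE x in \<nu>. norm ((u n x - u n x0)\<^sup>2) \<le> (2 * D)\<^sup>2" for n
        proof (rule AE_I2)
          fix x
          have "\<bar>u n x - u n x0\<bar> \<le> 2 * D" using bd[of n x] bd[of n x0] by linarith
          then show "norm ((u n x - u n x0)\<^sup>2) \<le> (2 * D)\<^sup>2"
            using power_mono[of "\<bar>u n x - u n x0\<bar>" "2 * D" 2] by simp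
        qed
      qed simp_all
      then have lim: "(\<lambda>n. \<integral>x. (u n x - u n x0)\<^sup>2 \<partial>\<nu>) \<longlonglongrightarrow> 0" by simp
      show ?thesis
      proof (rule Lim_null_comparison[OF _ lim])
        show "\<forall>\<^sub>F n in sequentially. norm (a n) \<le> (\<integral>x. (u n x - u n x0)\<^sup>2 \<partial>\<nu>)"
          using Var_le_second_moment[OF uL]
          by (intro always_eventually) (simp add: a_Var Var_nonneg)
      qed
    qed
    show "(a (Suc n))\<^sup>2 \<le> a n * a (Suc (Suc n))" for n
    proof -
      \<comment> \<open>Self-adjointness moves one \<open>M\<close> across: the pairing of
        \<open>M u_n\<close> with \<open>u_(n+1)\<close> equals that of \<open>u_n\<close> with
        \<open>M u_(n+1) = u_(n+2)\<close>. Cauchy-Schwarz then yields log-convexity.\<close>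
      have "a (Suc n) = (\<integral>x. u n x * u (Suc (Suc n)) x \<partial>\<nu>)"
        using averaging_self_adjoint[OF meas[of "Suc n"] meas[of n] bd bd]
        by (simp add: a_def u_Suc power2_eq_square)
      then have "\<bar>a (Suc n)\<bar> \<le> sqrt (a n) * sqrt (a (Suc (Suc n)))"
        using L2_cauchy_schwarz[OF uL[of n] uL[of "Suc (Suc n)"]] by (simp add: a_def)
      from power_mono[OF this, of 2] show ?thesis
        by (simp add: power_mult_distrib a_def)
    qed
  qed
  moreover have "a 0 = Var \<nu> f"
    using Var_add_const[OF L2_integrable[OF fL], of "- b"] by (simp add: a_Var u_def h_def[abs_def])
  moreover have "a 1 = Var \<nu> (averaging m f)"
  proof -
    have "integrable (m x) f" for x
      using bound by (intro K.integrable_const_bound[where B=B]) simp_all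
    then have "u 1 = (\<lambda>x. averaging m f x + (- b))"
      by (simp add: u_def h_def averaging_def fun_eq_iff K.prob_space)
    then show ?thesis
      using Var_add_const[OF L2_integrable[OF averaging_L2[OF fL]], of "- b"] by (simp add: a_Var)
  qed
  ultimately show ?thesis by simp
qed

sublocale finite_borel_measure \<nu>
  by unfold_locales (rule sets_nu)

text \<open>Density argument: the contraction is known for the Lipschitz approximant
  \<open>g\<close>, and the remainder \<open>r = f - g\<close> only needs the bound
  \<open>Var (M r) \<le> Var r\<close>.\<close>

theorem averaging_contracts:
  assumes f: "f \<in> L2 \<nu>"
  shows "sqrt (Var \<nu> (averaging m f)) \<le> c * sqrt (Var \<nu> f)"
proof (rule field_le_epsilon)
  fix e :: real assume "e > 0"
  \<comment> \<open>The remainder enters once with factor \<open>c\<close>, when \<open>g\<close> is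
    compared with \<open>f\<close>, and once with factor 1 through
    \<open>averaging m r\<close>.\<close>
  then have "e / (c + 1) > 0" using c by simp
  with L2_lipschitz_approximable[OF f] obtain g L where g: "L-lipschitz_on UNIV g" "bounded (range g)"
    and gL: "g \<in> L2 \<nu>" and close: "sqrt (\<integral>x. (f x - g x)\<^sup>2 \<partial>\<nu>) < e / (c + 1)"
    unfolding lipschitz_approximable_def by blast
  obtain B where B: "\<And>x. \<bar>g x\<bar> \<le> B"
    using g(2) by (auto simp: bounded_iff)
  define r where "r x = f x - g x" for x
  have rL: "r \<in> L2 \<nu>" unfolding r_def by (intro L2_diff f gL)
  have "Var \<nu> r \<le> (\<integral>x. (r x - 0)\<^sup>2 \<partial>\<nu>)" by (rule Var_le_second_moment[OF rL])
  then have Vr: "sqrt (Var \<nu> r) \<le> e / (c + 1)"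
    using close by (simp add: r_def) (meson less_imp_le order_trans real_sqrt_le_mono)
  have meas [measurable]: "f \<in> borel_measurable borel" "g \<in> borel_measurable borel" "r \<in> borel_measurable borel"
    using f gL rL by (auto simp: L2_def)
  have "AE x in \<nu>. averaging m f x = averaging m g x + averaging m r x"
  proof -
    have "(\<lambda>x. 1 * g x + 1 * r x) = f" by (simp add: r_def)
    then show ?thesis
      using averaging_linear_AE[OF L2_integrable[OF gL] L2_integrable[OF rL], of 1 1] by simp
  qed
  then have "Var \<nu> (averaging m f) = Var \<nu> (\<lambda>x. averaging m g x + averaging m r x)"
    by (rule Var_cong_AE) simp_all
  then have "sqrt (Var \<nu> (averaging m f)) \<le> sqrt (Var \<nu> (averaging m g)) + sqrt (Var \<nu> (averaging m r))"
    using Var_triangle[OF averaging_L2[OF gL] averaging_L2[OF rL]] by simp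
  also have "\<dots> \<le> c * sqrt (Var \<nu> g) + sqrt (Var \<nu> r)"
  proof (rule add_mono)
    have "sqrt (Var \<nu> (averaging m g)) \<le> sqrt (c\<^sup>2 * Var \<nu> g)"
      by (intro real_sqrt_le_mono averaging_contracts_lipschitz[OF g(1) B])
    then show "sqrt (Var \<nu> (averaging m g)) \<le> c * sqrt (Var \<nu> g)"
      using c by (simp add: real_sqrt_mult)
    show "sqrt (Var \<nu> (averaging m r)) \<le> sqrt (Var \<nu> r)"
      by (intro real_sqrt_le_mono Var_averaging_le rL)
  qed
  also have "\<dots> \<le> c * (sqrt (Var \<nu> f) + sqrt (Var \<nu> r)) + sqrt (Var \<nu> r)"
  proof (intro add_right_mono mult_left_mono c(1))
    have "Var \<nu> g = Var \<nu> (\<lambda>x. f x + (- 1) * r x)" by (simp add: r_def)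
    then show "sqrt (Var \<nu> g) \<le> sqrt (Var \<nu> f) + sqrt (Var \<nu> r)"
      using Var_triangle[OF f L2_scale[OF rL, of "- 1"]] by (simp only: Var_scale) simp
  qed
  also have "\<dots> = c * sqrt (Var \<nu> f) + (c + 1) * sqrt (Var \<nu> r)"
    by (simp add: algebra_simps)
  also have "\<dots> \<le> c * sqrt (Var \<nu> f) + e"
    using Vr c by (simp add: field_simps)
  finally show "sqrt (Var \<nu> (averaging m f)) \<le> c * sqrt (Var \<nu> f) + e" .
qed

section \<open>Poincare inequalities and injectivity\<close>

lemma Var_averaging_contracts:
  assumes "f \<in> L2 \<nu>"
  shows "Var \<nu> (averaging m f) \<le> c\<^sup>2 * Var \<nu> f"
  using power_mono[OF averaging_contracts[OF assms], of 2]
  by (simp add: power_mult_distrib Var_nonneg)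

lemma poincare_kernel_variance:
  assumes f: "f \<in> L2 \<nu>"
  shows "(1 - c\<^sup>2) * Var \<nu> f \<le> (\<integral>x. Var (m x) f \<partial>\<nu>)"
  using Var_averaging_contracts[OF f] by (simp add: integral_Var_kernel[OF f] algebra_simps)

lemma poincare_gradient:
  assumes f: "f \<in> L2 \<nu>"
  shows "2 * (1 - c) * Var \<nu> f \<le> (\<integral>x. (\<integral>y. (f y - f x)\<^sup>2 \<partial>m x) \<partial>\<nu>)"
proof -
  let ?Mf = "averaging m f"
  define b where "b = (\<integral>x. f x \<partial>\<nu>)"
  have b': "(\<integral>x. ?Mf x \<partial>\<nu>) = b"
    unfolding b_def by (rule integral_averaging[OF L2_integrable[OF f]])
  have Mf: "?Mf \<in> L2 \<nu>" by (rule averaging_L2[OF f])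
  \<comment> \<open>Subtracting \<open>b\<^sup>2\<close> turns the pairing into a covariance, since
    \<open>f\<close> and \<open>M f\<close> share the mean \<open>b\<close>; Cauchy-Schwarz then
    involves variances only.\<close>
  have "(\<integral>x. f x * ?Mf x \<partial>\<nu>) - b\<^sup>2 = (\<integral>x. (f x - b) * (?Mf x - b) \<partial>\<nu>)"
  proof -
    have "(\<integral>x. (f x - b) * (?Mf x - b) \<partial>\<nu>) = (\<integral>x. f x * ?Mf x - b * f x - b * ?Mf x + b * b \<partial>\<nu>)"
      by (simp add: algebra_simps)
    also have "\<dots> = (\<integral>x. f x * ?Mf x \<partial>\<nu>) - b * b - b * b + b * b"
      using L2_mult_integrable[OF f Mf] L2_integrable[OF f] L2_integrable[OF Mf]
      by (simp add: b' prob_UNIV flip: b_def)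
    finally show ?thesis by (simp add: power2_eq_square)
  qed
  also have "\<dots> \<le> sqrt (\<integral>x. (f x - b)\<^sup>2 \<partial>\<nu>) * sqrt (\<integral>x. (?Mf x - b)\<^sup>2 \<partial>\<nu>)"
    using L2_cauchy_schwarz[OF L2_diff[OF f L2_const] L2_diff[OF Mf L2_const], of b b] by linarith
  also have "\<dots> = sqrt (Var \<nu> f) * sqrt (Var \<nu> ?Mf)"
    unfolding Var_def b' b_def[symmetric] ..
  also have "\<dots> \<le> sqrt (Var \<nu> f) * (c * sqrt (Var \<nu> f))"
    by (intro mult_left_mono averaging_contracts f) (simp add: Var_nonneg)
  also have "\<dots> = c * Var \<nu> f"
    using Var_nonneg[of \<nu> f] by simp
  finally have "(\<integral>x. f x * ?Mf x \<partial>\<nu>) - b\<^sup>2 \<le> c * Var \<nu> f" .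
  moreover have "Var \<nu> f = (\<integral>x. (f x)\<^sup>2 \<partial>\<nu>) - b\<^sup>2"
    unfolding b_def by (rule Var_eq[OF f])
  ultimately have "Var \<nu> f - c * Var \<nu> f \<le> (\<integral>x. (f x)\<^sup>2 \<partial>\<nu>) - (\<integral>x. f x * ?Mf x \<partial>\<nu>)"
    by linarith
  from mult_left_mono[OF this, of 2] show ?thesis
    unfolding integral_gradient_sq[OF f] by (simp add: algebra_simps)
qed

lemma laplacian_eq: "- laplacian m f x - l * f x = (1 - l) * f x - averaging m f x"
  by (simp add: laplacian_def algebra_simps)

text \<open>If \<open>M f = d f\<close> up to a constant, then \<open>Var (M f) = d^2 Var f\<close>,
  which the contraction by \<open>c^2 < d^2\<close> allows only for
  \<open>Var f = 0\<close>.\<close>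

lemma averaging_shift_injective:
  assumes f: "f \<in> L2 \<nu>" and d: "c < d"
    and eq: "eq_mod_const \<nu> (\<lambda>x. d * f x - averaging m f x) (\<lambda>_. 0)"
  shows "eq_mod_const \<nu> f (\<lambda>_. 0)"
proof -
  obtain k where k: "AE x in \<nu>. d * f x - averaging m f x = 0 + k"
    using eq unfolding eq_mod_const_def by auto
  have [measurable]: "f \<in> borel_measurable borel" using f by (simp add: L2_def)
  have "AE x in \<nu>. averaging m f x = d * f x + (- k)"
    using k by eventually_elim simp
  then have "Var \<nu> (averaging m f) = Var \<nu> (\<lambda>x. d * f x + (- k))"
    by (rule Var_cong_AE) simp_all
  also have "\<dots> = d\<^sup>2 * Var \<nu> f"
    using L2_integrable[OF f] by (subst Var_add_const) (auto simp: Var_scale)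
  finally have le: "d\<^sup>2 * Var \<nu> f \<le> c\<^sup>2 * Var \<nu> f"
    using Var_averaging_contracts[OF f] by simp
  have "c\<^sup>2 < d\<^sup>2" using c d by (intro power_strict_mono) auto
  have "Var \<nu> f = 0"
  proof (rule ccontr)
    assume "Var \<nu> f \<noteq> 0"
    then have "Var \<nu> f > 0" using Var_nonneg[of \<nu> f] by simp
    with \<open>c\<^sup>2 < d\<^sup>2\<close> have "c\<^sup>2 * Var \<nu> f < d\<^sup>2 * Var \<nu> f" by simp
    with le show False by simp
  qed
  from Var_eq_0_imp_AE[OF f this] show ?thesis
    unfolding eq_mod_const_def by (intro exI[of _ "\<integral>y. f y \<partial>\<nu>"]) simp
qed

subsection \<open>Spectrum\<close>

text \<open>By invariance a \<open>\<nu>\<close>-null set is null for \<open>m x\<close> at almost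
  every \<open>x\<close>. It transfers the pointwise bounds on the Neumann series to the measures
  against which \<open>M\<close> integrates.\<close>

lemma AE_kernel:
  assumes "Measurable.pred borel P" "AE x in \<nu>. P x"
  shows "AE x in \<nu>. AE y in m x. P y"
  using AE_bind[OF kernel_subprob assms(1)] assms(2) unfolding invariant by blast

text \<open>The Neumann series \<open>(\<Sum>n. M\<^sup>n g / d\<^sup>n\<^sup>+\<^sup>1)\<close> of the centered \<open>g\<close>.
  For \<open>c < p < d\<close> the terms satisfy \<open>\<bar>M\<^sup>n g\<bar> \<le> p\<^sup>n w\<close> almost surely with a single \<open>w\<close> in
  \<open>L\<^sup>2(\<nu>)\<close>, which gives convergence and lets \<open>M\<close> pass through the sum.\<close>

lemma resolvent_surjective:
  assumes g: "g \<in> L2 \<nu>" and d: "c < d"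
  shows "\<exists>f\<in>L2 \<nu>. AE x in \<nu>. d * f x - averaging m f x = g x - (\<integral>y. g y \<partial>\<nu>)"
proof -
  \<comment> \<open>A rate strictly between \<open>c\<close> and \<open>d\<close>: the gap to
    \<open>c\<close> makes the normalised squares summable, the gap to \<open>d\<close> makes the
    series converge.\<close>
  define p where "p = (c + d) / 2"
  have p: "c < p" "p < d" "0 < p" "0 < d" using c d by (auto simp: p_def)
  define G where "G n = (averaging m ^^ n) (\<lambda>x. g x - (\<integral>y. g y \<partial>\<nu>))" for n
  have G_Suc: "G (Suc n) = averaging m (G n)" for n by (simp add: G_def)
  have GL: "G n \<in> L2 \<nu>" for n
  proof (induction n)
    case 0
    show ?case unfolding G_def using centered_L2[OF g] by simp
  qed (simp add: G_Suc averaging_L2)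
  have meas [measurable]: "G n \<in> borel_measurable borel" for n
    using GL[of n] by (simp add: L2_def)
  have mean: "(\<integral>x. G n x \<partial>\<nu>) = 0" for n
  proof (induction n)
    case 0
    show ?case using L2_integrable[OF g] by (simp add: G_def prob_UNIV)
  next
    case (Suc n)
    then show ?case using integral_averaging[OF L2_integrable[OF GL[of n]]] by (simp add: G_Suc)
  qed
  define A where "A = Var \<nu> (G 0)"
  have decay: "(\<integral>x. (G n x)\<^sup>2 \<partial>\<nu>) \<le> (c\<^sup>2) ^ n * A" for n
  proof -
    have "Var \<nu> (G n) \<le> (c\<^sup>2) ^ n * A"
    proof (induction n)
      case (Suc n)
      have "Var \<nu> (G (Suc n)) \<le> c\<^sup>2 * Var \<nu> (G n)"
        unfolding G_Suc by (rule Var_averaging_contracts[OF GL])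
      also have "\<dots> \<le> c\<^sup>2 * ((c\<^sup>2) ^ n * A)"
        by (rule mult_left_mono[OF Suc]) simp
      finally show ?case by (simp add: mult.assoc)
    qed (simp add: A_def)
    then show ?thesis by (simp add: Var_def mean)
  qed
  \<comment> \<open>Each normalised square is at most their sum \<open>H\<close>, so the root
    \<open>w\<close> of \<open>H\<close> bounds all \<open>|G n| / p ^ n\<close> at once. The
    conversion \<open>enn2real\<close> spoils this only where \<open>H\<close> is infinite, a null
    set by \<open>H_AE\<close>.\<close>
  define q where "q n x = (G n x / p ^ n)\<^sup>2" for n x
  define H where "H x = (\<Sum>n. ennreal (q n x))" for x
  define w where "w x = sqrt (enn2real (H x))" for x
  have [measurable]: "q n \<in> borel_measurable borel" for n unfolding q_def by measurable
  have [measurable]: "H \<in> borel_measurable borel" unfolding H_def by measurable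
  have [measurable]: "w \<in> borel_measurable borel" unfolding w_def by measurable
  \<comment> \<open>Decay by \<open>c^2\<close> against normalisation by \<open>p^2\<close> leaves
    the ratio \<open>(c / p)^2 < 1\<close>, hence \<open>H\<close> has finite integral.\<close>
  have q_bound: "(\<integral>\<^sup>+x. ennreal (q n x) \<partial>\<nu>) \<le> ennreal (((c / p)\<^sup>2) ^ n * A)" for n
  proof -
    have q_eq: "q n x = (G n x)\<^sup>2 * (1 / (p\<^sup>2) ^ n)" for x
      by (simp add: q_def power_divide flip: power_mult) (simp add: mult.commute)
    have "integrable \<nu> (q n)"
      unfolding q_eq[abs_def] using GL[of n] by (intro integrable_mult_left) (simp add: L2_def)
    then have "(\<integral>\<^sup>+x. ennreal (q n x) \<partial>\<nu>) = ennreal (\<integral>x. q n x \<partial>\<nu>)"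
      by (rule nn_integral_eq_integral) (simp add: q_def)
    also have "(\<integral>x. q n x \<partial>\<nu>) = (\<integral>x. (G n x)\<^sup>2 \<partial>\<nu>) * (1 / (p\<^sup>2) ^ n)"
      unfolding q_eq by (rule integral_mult_left_zero)
    also have "\<dots> \<le> ((c\<^sup>2) ^ n * A) * (1 / (p\<^sup>2) ^ n)"
      by (rule mult_right_mono[OF decay]) simp
    also have "\<dots> = ((c / p)\<^sup>2) ^ n * A"
      by (simp add: power_divide)
    finally show ?thesis by (simp add: ennreal_leI)
  qed
  have H_fin: "(\<integral>\<^sup>+x. H x \<partial>\<nu>) < \<infinity>"
  proof -
    have "(\<integral>\<^sup>+x. H x \<partial>\<nu>) = (\<Sum>n. \<integral>\<^sup>+x. ennreal (q n x) \<partial>\<nu>)"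
      unfolding H_def by (rule nn_integral_suminf) simp
    also have "\<dots> \<le> (\<Sum>n. ennreal (((c / p)\<^sup>2) ^ n * A))"
      by (intro suminf_le q_bound) auto
    also have "\<dots> < \<infinity>"
    proof -
      have "(c / p)\<^sup>2 < 1" using c p by (simp add: abs_square_less_1)
      then have "summable (\<lambda>n. ((c / p)\<^sup>2) ^ n * A)"
        by (intro summable_mult2 summable_geometric) simp
      moreover have "0 \<le> ((c / p)\<^sup>2) ^ n * A" for n
        unfolding A_def by (intro mult_nonneg_nonneg Var_nonneg) simp
      ultimately have "(\<Sum>n. ennreal (((c / p)\<^sup>2) ^ n * A)) \<noteq> top"
        by (rule ennreal_suminf_neq_top)
      then show ?thesis by (simp only: less_top infinity_ennreal_def)
    qed
    finally show ?thesis .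
  qed
  have H_AE: "AE x in \<nu>. H x \<noteq> \<infinity>"
    using H_fin by (intro nn_integral_PInf_AE) auto
  have wL: "w \<in> L2 \<nu>"
  proof -
    have "(w x)\<^sup>2 = enn2real (H x)" for x by (simp add: w_def)
    moreover have "integrable \<nu> (\<lambda>x. enn2real (H x))"
    proof (rule integrableI_nonneg)
      have "(\<integral>\<^sup>+x. ennreal (enn2real (H x)) \<partial>\<nu>) = (\<integral>\<^sup>+x. H x \<partial>\<nu>)"
        using H_AE by (intro nn_integral_cong_AE) (auto simp: less_top)
      then show "(\<integral>\<^sup>+x. ennreal (enn2real (H x)) \<partial>\<nu>) < \<infinity>" using H_fin by simp
    qed simp_all
    ultimately show ?thesis by (simp add: L2_def)
  qed
  define P where "P x \<longleftrightarrow> (\<forall>n. \<bar>G n x\<bar> \<le> p ^ n * w x)" for x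
  have P_meas: "Measurable.pred borel P" unfolding P_def by measurable
  have P_AE: "AE x in \<nu>. P x"
    using H_AE
  proof eventually_elim
    case (elim x)
    show "P x"
      unfolding P_def
    proof
      fix n
      have "ennreal (q n x) \<le> H x"
        unfolding H_def using sum_le_suminf[of "\<lambda>n. ennreal (q n x)" "{n}"] by simp
      also have "H x = ennreal (enn2real (H x))" using elim by (simp add: less_top)
      finally have "q n x \<le> enn2real (H x)" by simp
      from real_sqrt_le_mono[OF this] have "\<bar>G n x\<bar> / p ^ n \<le> w x"
        using p by (simp add: q_def w_def)
      then show "\<bar>G n x\<bar> \<le> p ^ n * w x" using p by (simp add: field_simps)
    qed
  qed
  define s where "s N x = (\<Sum>n<N. G n x / d ^ Suc n)" for N x
  define f where "f x = (\<Sum>n. G n x / d ^ Suc n)" for x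
  have [measurable]: "s N \<in> borel_measurable borel" for N unfolding s_def by measurable
  have [measurable]: "f \<in> borel_measurable borel" unfolding f_def by measurable
  have s_term: "norm (G n x / d ^ Suc n) \<le> w x / d * (p / d) ^ n" if "P x" for x n
    using that p by (simp add: P_def power_divide field_simps)
  have geo: "(\<lambda>n. w x / d * (p / d) ^ n) sums (w x / (d - p))" for x
  proof -
    have "(\<lambda>n. w x / d * (p / d) ^ n) sums (w x / d * (1 / (1 - p / d)))"
      using p by (intro sums_mult geometric_sums) simp
    also have "w x / d * (1 / (1 - p / d)) = w x / (d - p)"
      using p by (simp add: field_simps)
    finally show ?thesis .
  qed
  have s_bound: "\<bar>s N x\<bar> \<le> w x / (d - p)" if "P x" for x N
  proof -
    have "\<bar>s N x\<bar> \<le> (\<Sum>n<N. norm (G n x / d ^ Suc n))"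
      unfolding s_def real_norm_def[symmetric] by (rule norm_sum)
    also have "\<dots> \<le> (\<Sum>n<N. w x / d * (p / d) ^ n)"
      by (intro sum_mono s_term that)
    also have "\<dots> \<le> (\<Sum>n. w x / d * (p / d) ^ n)"
      using p geo by (intro sum_le_suminf) (auto simp: sums_iff w_def)
    also have "\<dots> = w x / (d - p)" using geo by (simp add: sums_iff)
    finally show ?thesis .
  qed
  have s_lim: "(\<lambda>N. s N x) \<longlonglongrightarrow> f x" if "P x" for x
  proof -
    have "summable (\<lambda>n. G n x / d ^ Suc n)"
      by (rule summable_comparison_test'[OF sums_summable[OF geo]]) (rule s_term[OF that])
    then show ?thesis unfolding s_def f_def by (rule summable_LIMSEQ)
  qed
  have fL: "f \<in> L2 \<nu>"
  proof (rule L2_dominated[OF L2_scale[OF wL, of "1 / (d - p)"]])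
    show "AE x in \<nu>. \<bar>f x\<bar> \<le> \<bar>1 / (d - p) * w x\<bar>"
      using P_AE
    proof eventually_elim
      case (elim x)
      have "\<bar>f x\<bar> \<le> w x / (d - p)"
        by (rule LIMSEQ_le_const2[OF tendsto_rabs[OF s_lim[OF elim]]]) (use s_bound[OF elim] in blast)
      then show ?case using p by (simp add: w_def)
    qed
  qed simp
  have "AE x in \<nu>. \<forall>n. integrable (m x) (G n)"
    unfolding AE_all_countable using AE_kernel_integrable[OF L2_integrable[OF GL]] by blast
  \<comment> \<open>Convergence is needed at \<open>x\<close> itself and at
    \<open>m x\<close>-almost every \<open>y\<close>, dominated there by a multiple of
    \<open>w\<close>; four almost-sure facts are combined for this.\<close>
  with P_AE AE_kernel[OF P_meas P_AE] AE_kernel_integrable[OF L2_integrable[OF wL]]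
  have "AE x in \<nu>. d * f x - averaging m f x = G 0 x"
  proof eventually_elim
    case (elim x)
    have "(\<lambda>N. averaging m (s N) x) \<longlonglongrightarrow> averaging m f x"
      unfolding averaging_def
    proof (rule integral_dominated_convergence)
      show "integrable (m x) (\<lambda>y. w y / (d - p))" using elim by simp
      show "AE y in m x. (\<lambda>N. s N y) \<longlonglongrightarrow> f y"
        using elim(2) by eventually_elim (rule s_lim)
      show "AE y in m x. norm (s N y) \<le> w y / (d - p)" for N
        using elim(2) by eventually_elim (simp add: s_bound)
    qed simp_all
    \<comment> \<open>The offset by one is deliberate: \<open>d * s (Suc N)\<close> and
      \<open>M (s N)\<close> agree in all terms except the initial \<open>G 0\<close>, so the
      difference does not depend on \<open>N\<close>.\<close>
    then have "(\<lambda>N. d * s (Suc N) x - averaging m (s N) x) \<longlonglongrightarrow> d * f x - averaging m f x"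
      by (intro tendsto_intros LIMSEQ_Suc s_lim elim)
    moreover have "d * s (Suc N) x - averaging m (s N) x = G 0 x" for N
    proof -
      have "averaging m (s N) x = (\<Sum>n<N. G (Suc n) x / d ^ Suc n)"
        unfolding averaging_def s_def G_Suc using elim by (subst Bochner_Integration.integral_sum) auto
      moreover have "d * s (Suc N) x = (\<Sum>n<Suc N. G n x / d ^ n)"
        unfolding s_def sum_distrib_left using p by (intro sum.cong) auto
      ultimately show ?thesis unfolding sum.lessThan_Suc_shift by simp
    qed
    ultimately show ?case by (simp add: LIMSEQ_const_iff)
  qed
  moreover have "G 0 x = g x - (\<integral>y. g y \<partial>\<nu>)" for x
    by (simp add: G_def)
  ultimately show ?thesis using fL by (intro bexI[of _ f]) simp_all
qed

lemma spectrum_lower_bound: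
  assumes "l \<in> spectrum_mod_const \<nu> (\<lambda>f x. - laplacian m f x)"
  shows "1 - c \<le> l"
proof (rule ccontr)
  assume "\<not> 1 - c \<le> l"
  then have d: "c < 1 - l" by simp
  have "eq_mod_const \<nu> f g"
    if f: "f \<in> L2 \<nu>" and g: "g \<in> L2 \<nu>"
      and eq: "eq_mod_const \<nu> (\<lambda>x. - laplacian m f x - l * f x) (\<lambda>x. - laplacian m g x - l * g x)" for f g
  proof -
    obtain k where k: "AE x in \<nu>. (1 - l) * f x - averaging m f x = (1 - l) * g x - averaging m g x + k"
      using eq unfolding eq_mod_const_def laplacian_eq by blast
    \<comment> \<open>Almost-sure linearity reduces injectivity to a trivial kernel, applied to the
      difference.\<close>
    have "AE x in \<nu>. averaging m (\<lambda>x. f x - g x) x = averaging m f x - averaging m g x"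
      using averaging_linear_AE[OF L2_integrable[OF f] L2_integrable[OF g], of 1 "- 1"] by simp
    with k have "AE x in \<nu>. (1 - l) * (f x - g x) - averaging m (\<lambda>x. f x - g x) x = 0 + k"
      by eventually_elim (simp add: algebra_simps)
    then have "eq_mod_const \<nu> (\<lambda>x. (1 - l) * (f x - g x) - averaging m (\<lambda>x. f x - g x) x) (\<lambda>_. 0)"
      unfolding eq_mod_const_def by blast
    from averaging_shift_injective[OF L2_diff[OF f g] d this]
    obtain k' where "AE x in \<nu>. f x - g x = 0 + k'"
      unfolding eq_mod_const_def by blast
    then have "AE x in \<nu>. f x = g x + k'" by eventually_elim simp
    then show ?thesis unfolding eq_mod_const_def by blast
  qed
  moreover have "\<exists>f\<in>L2 \<nu>. eq_mod_const \<nu> (\<lambda>x. - laplacian m f x - l * f x) g" if g: "g \<in> L2 \<nu>" for g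
  proof -
    \<comment> \<open>The equation is solved for the centered \<open>g\<close>, which is the same
      class modulo constants.\<close>
    from resolvent_surjective[OF g d] obtain f where f: "f \<in> L2 \<nu>"
      "AE x in \<nu>. (1 - l) * f x - averaging m f x = g x + - (\<integral>y. g y \<partial>\<nu>)"
      by auto
    then show ?thesis
      unfolding eq_mod_const_def laplacian_eq by blast
  qed
  ultimately show False
    using assms unfolding spectrum_mod_const_def by blast
qed

lemma eigenvalue_lower_bound:
  assumes "eigenvalue_mod_const \<nu> (\<lambda>f x. - laplacian m f x) l"
  shows "1 - c \<le> l"
proof (rule ccontr)
  assume "\<not> 1 - c \<le> l"
  then have d: "c < 1 - l" by simp
  obtain f k where f: "f \<in> L2 \<nu>" and nc: "\<not> eq_mod_const \<nu> f (\<lambda>_. 0)"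
    and k: "AE x in \<nu>. - laplacian m f x = l * f x + k"
    using assms unfolding eigenvalue_mod_const_def eq_mod_const_def by blast
  have "AE x in \<nu>. (1 - l) * f x - averaging m f x = 0 + k"
    using k by eventually_elim (simp add: laplacian_def algebra_simps)
  then have "eq_mod_const \<nu> (\<lambda>x. (1 - l) * f x - averaging m f x) (\<lambda>_. 0)"
    unfolding eq_mod_const_def by blast
  with averaging_shift_injective[OF f d] nc show False by blast
qed

end

subsection \<open>From the curvature bound to the contraction of the kernel\<close>

text \<open>The diagonal coupling costs nothing. This supplies the case \<open>x = y\<close>, on
  which the curvature bound is silent.\<close>

lemma transport_dist_self:
  fixes \<mu> :: "'a::polish_space measure"
  assumes "sets \<mu> = sets borel"
  shows "transport_dist \<mu> \<mu> = 0"
proof -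
  define \<xi> where "\<xi> = distr \<mu> borel (\<lambda>x. (x, x))"
  note [measurable_cong] = assms
  have diag: "(\<lambda>x. (x, x)) \<in> \<mu> \<rightarrow>\<^sub>M borel"
    unfolding borel_prod[symmetric] by measurable
  have [measurable]: "fst \<in> (borel :: ('a \<times> 'a) measure) \<rightarrow>\<^sub>M (borel :: 'a measure)"
    "snd \<in> (borel :: ('a \<times> 'a) measure) \<rightarrow>\<^sub>M (borel :: 'a measure)"
    unfolding borel_prod[symmetric] by measurable
  have "distr \<mu> borel (\<lambda>x. x) = \<mu>"
    using assms by (rule distr_id2[OF sym])
  then have "\<xi> \<in> couplings \<mu> \<mu>"
    unfolding couplings_def \<xi>_def using diag by (simp add: distr_distr comp_def)
  then have "transport_dist \<mu> \<mu> \<le> (\<integral>\<^sup>+z. ennreal (dist (fst z) (snd z)) \<partial>\<xi>)"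
    unfolding transport_dist_def by (rule INF_lower)
  also have "\<dots> = 0"
    unfolding \<xi>_def using diag by (simp add: nn_integral_distr)
  finally show ?thesis by simp
qed

lemma ricci_curvature_transport:
  assumes "ereal \<kappa> \<le> ricci_curvature m x y" "x \<noteq> y"
  shows "\<kappa> \<le> 1" "transport_dist (m x) (m y) \<le> ennreal ((1 - \<kappa>) * dist x y)"
proof -
  have d: "dist x y > 0" using assms(2) by simp
  have "\<kappa> \<le> 1 \<and> transport_dist (m x) (m y) \<le> ennreal ((1 - \<kappa>) * dist x y)"
  proof (cases "transport_dist (m x) (m y)")
    case (real r)
    then have "ereal \<kappa> \<le> ereal (1 - r / dist x y)"
      using assms(1) by (simp add: ricci_curvature_def enn2ereal_ennreal one_ereal_def assms(2))
    then have "\<kappa> \<le> 1 - r / dist x y" by simp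
    moreover from this have "r \<le> (1 - \<kappa>) * dist x y" using d by (simp add: field_simps)
    moreover have "0 \<le> r / dist x y" using real d by simp
    then have "\<kappa> \<le> 1" using \<open>\<kappa> \<le> 1 - r / dist x y\<close> by linarith
    ultimately show ?thesis using real by (simp add: ennreal_leI)
  next
    \<comment> \<open>An infinite transport distance would make the curvature minus infinity, below
      every real \<open>\<kappa>\<close>.\<close>
    case top
    then show ?thesis using assms by (simp add: ricci_curvature_def one_ereal_def)
  qed
  then show "\<kappa> \<le> 1" "transport_dist (m x) (m y) \<le> ennreal ((1 - \<kappa>) * dist x y)" by auto
qed

text \<open>Two distinct points are required because \<open>\<kappa> \<le> 1\<close>, that is
  \<open>0 \<le> 1 - \<kappa>\<close>, is deduced from the curvature of an actual pair.\<close>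

lemma curved_walkI:
  fixes m :: "'a::polish_space \<Rightarrow> 'a measure"
  assumes m: "random_walk m" and \<nu>: "reversible_distribution m \<nu>"
    and \<kappa>: "\<kappa> > 0" "ricci_curvature_at_least m \<kappa>" and fin: "spread m \<nu> < \<infinity>"
    and two: "(x :: 'a) \<noteq> y"
  shows "\<exists>S. curved_walk m \<nu> (1 - \<kappa>) S"
proof -
  define I where "I = (\<integral>\<^sup>+x. (spread_at m x)\<^sup>2 \<partial>\<nu>)"
  have "I \<noteq> \<infinity>" using fin by (auto simp: spread_def I_def ennreal_root2_def)
  have "curved_walk m \<nu> (1 - \<kappa>) (enn2real I)"
  proof
    show kernel: "m \<in> borel \<rightarrow>\<^sub>M prob_algebra borel" using m by (simp add: random_walk_def)
    show "\<nu> \<in> space (prob_algebra borel)" "\<nu> \<bind> m = \<nu>"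
      and "\<nu> \<bind> (\<lambda>x. m x \<bind> (\<lambda>y. return borel (x, y))) = \<nu> \<bind> (\<lambda>y. m y \<bind> (\<lambda>x. return borel (x, y)))"
      using \<nu> by (auto simp: reversible_distribution_def invariant_distribution_def)
    have curv: "ereal \<kappa> \<le> ricci_curvature m x y" if "x \<noteq> y" for x y
      using \<kappa>(2) that by (simp add: ricci_curvature_at_least_def)
    show "0 \<le> 1 - \<kappa>" "1 - \<kappa> < 1"
      using ricci_curvature_transport(1)[OF curv[OF two] two] \<kappa>(1) by auto
    show "transport_dist (m x) (m y) \<le> ennreal ((1 - \<kappa>) * dist x y)" for x y
    proof (cases "x = y")
      case True
      have "sets (m x) = sets borel"
        using measurable_space[OF kernel, of x] by (simp add: space_prob_algebra)
      then show ?thesis using True by (simp add: transport_dist_self)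
    next
      case False
      then show ?thesis using ricci_curvature_transport(2)[OF curv[OF False] False] by simp
    qed
    show "(\<integral>\<^sup>+x. (spread_at m x)\<^sup>2 \<partial>\<nu>) \<le> ennreal (enn2real I)"
      using \<open>I \<noteq> \<infinity>\<close> by (simp add: I_def less_top)
  qed simp
  then show ?thesis ..
qed

lemma Var_singleton:
  fixes f :: "'a \<Rightarrow> real"
  assumes "prob_space \<mu>" "\<And>x y :: 'a. x = y"
  shows "Var \<mu> f = 0"
proof -
  interpret prob_space \<mu> by fact
  have "f = (\<lambda>_. f undefined)" by (rule ext) (metis assms(2))
  then have "Var \<mu> f = Var \<mu> (\<lambda>_. f undefined)" by (rule arg_cong)
  then show ?thesis by (simp add: Var_def prob_space)
qed

section \<open>Spectral gap and Poincare inequalities for the walk\<close>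

theorem corollary30:
  fixes m :: "'a::polish_space \<Rightarrow> 'a measure" and \<nu> :: "'a measure" and \<kappa> :: real
  assumes "random_walk m"
    and "invariant_distribution m \<nu>"
    and "ergodic_walk m \<nu>"
    and "\<kappa> > 0"
    and "ricci_curvature_at_least m \<kappa>"
    and "spread m \<nu> < \<infinity>"
    and "reversible_distribution m \<nu>"
  shows "(\<forall>l. eigenvalue_mod_const \<nu> (\<lambda>f x. - laplacian m f x) l \<longrightarrow> \<kappa> \<le> l) \<and>
         (\<forall>l\<in>spectrum_mod_const \<nu> (\<lambda>f x. - laplacian m f x). \<kappa> \<le> l) \<and>
         (\<forall>f\<in>L2 \<nu>. Var \<nu> f \<le> 1 / (\<kappa> * (2 - \<kappa>)) * (\<integral>x. Var (m x) f \<partial>\<nu>)) \<and>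
         (\<forall>f\<in>L2 \<nu>. Var \<nu> f \<le> 1 / (2 * \<kappa>) * (\<integral>x. (\<integral>y. (f y - f x)\<^sup>2 \<partial>m x) \<partial>\<nu>))"
proof (cases "\<exists>x y :: 'a. x \<noteq> y")
  case True
  then obtain S where "curved_walk m \<nu> (1 - \<kappa>) S"
    using curved_walkI[OF assms(1,7,4,5,6)] by blast
  then interpret curved_walk m \<nu> "1 - \<kappa>" S .
  have "\<kappa> \<le> 1" using c by simp
  have "Var \<nu> f \<le> 1 / (\<kappa> * (2 - \<kappa>)) * (\<integral>x. Var (m x) f \<partial>\<nu>)" if "f \<in> L2 \<nu>" for f
  proof -
    have "1 - (1 - \<kappa>)\<^sup>2 = \<kappa> * (2 - \<kappa>)" by (simp add: power2_eq_square algebra_simps)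
    \<comment> \<open>Here \<open>\<kappa> \<le> 1\<close> guarantees that dividing by
      \<open>2 - \<kappa>\<close> preserves the inequality.\<close>
    moreover have "0 < \<kappa> * (2 - \<kappa>)" using \<open>\<kappa> > 0\<close> \<open>\<kappa> \<le> 1\<close> by simp
    ultimately show ?thesis
      using poincare_kernel_variance[OF that] by (simp add: pos_le_divide_eq mult.commute)
  qed
  moreover have "Var \<nu> f \<le> 1 / (2 * \<kappa>) * (\<integral>x. (\<integral>y. (f y - f x)\<^sup>2 \<partial>m x) \<partial>\<nu>)" if "f \<in> L2 \<nu>" for f
    using poincare_gradient[OF that] \<open>\<kappa> > 0\<close> by (simp add: pos_le_divide_eq mult_ac)
  ultimately show ?thesis
    using eigenvalue_lower_bound spectrum_lower_bound by auto
next
  \<comment> \<open>On a one-point space the curvature bound is vacuous, so \<open>\<kappa>\<close> may exceed \<open>1\<close>.\<close>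
  case False
  then have single: "x = y" for x y :: 'a by blast
  interpret invariant_kernel m \<nu>
    using assms(1,2) by unfold_locales (auto simp: random_walk_def invariant_distribution_def)
  \<comment> \<open>The quotient modulo constants is the zero space: it has no eigenvectors, and
    every operator on it is bijective, so the spectrum is empty.\<close>
  have all_eq: "eq_mod_const \<nu> f g" for f g
    unfolding eq_mod_const_def
  proof (intro exI AE_I2)
    show "f x = g x + (f undefined - g undefined)" for x
      using single[of x undefined] by simp
  qed
  have "(\<integral>x. (\<integral>y. (f y - f x)\<^sup>2 \<partial>m x) \<partial>\<nu>) = 0" for f :: "'a \<Rightarrow> real"
  proof -
    have "(f y - f x)\<^sup>2 = 0" for x y
      using arg_cong[OF single[of x y], of f] by simp
    then show ?thesis by (simp only:) simp
  qed
  then show ?thesis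
    using all_eq Var_singleton[OF prob_space_axioms single] Var_singleton[OF prob_space_kernel single]
    by (auto simp: eigenvalue_mod_const_def spectrum_mod_const_def)
qed

end
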